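(* Let $K$ be a field, $\mathcal{G}=(G^0,\mathcal{G}^1,r,s)$ an ultragraph and $I$ a (two-sided) ideal of the ultragraph Leavitt path algebra $L_K(\mathcal{G})$. Then there exists a generating set for $I$ (as an ideal) consisting of elements of $I$ of the form $$\Big(p_A+\sum_{i=2}^m k_i s_c^{r_i}\Big)\Big(p_A-\sum_{e\in S}s_es_e^*\Big),$$ where $A\in\mathcal{G}^0$, $k_2,\ldots,k_m\in K$, $r_1,\ldots,r_m$ are positive integers, $S$ is a finite subset of $\mathcal{G}^1$ consisting of edges with the same source vertex $v\in A$, and, whenever $k_i\neq 0$ for some $2\le i\le m$, $c$ is the unique cycle based at $v$ such that $A\subseteq r(c)$.
   Context: An ultragraph $\mathcal{G}=(G^0,\mathcal{G}^1,r,s)$ consists of a countable set $G^0$ of vertices, a countable set $\mathcal{G}^1$ of edges, and maps $s:\mathcal{G}^1\to G^0$, $r:\mathcal{G}^1\to\mathcal{P}(G^0)\setminus\{\varnothing\}$. A vertex $v$ is regular if $0<|s^{-1}(v)|<\infty$. $\mathcal{G}^0$ denotes the smallest subset of $\mathcal{P}(G^0)$ that contains $\{v\}$ for all $v\in G^0$, contains $r(e)$ for all $e\in\mathcal{G}^1$, and is closed under relative complements, finite unions and finite intersections. A finite path is either an element $A\in\mathcal{G}^0$ (of length $0$, with $s(A)=r(A)=A$) or a sequence $\alpha=\alpha_1\cdots\alpha_n$ of edges with $s(\alpha_{i+1})\in r(\alpha_i)$ for $1\le i\le n-1$ (of length $|\alpha|=n$, with $s(\alpha)=s(\alpha_1)$,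 $r(\alpha)=r(\alpha_n)$). A closed path (based at $v=s(\alpha)$) is a path $\alpha$ with $|\alpha|\ge1$ and $s(\alpha)\in r(\alpha)$; a cycle (based at $v$) is a closed path (based at $v$) with $s(\alpha_i)\ne s(\alpha_j)$ for all $i\neq j$. For a field $K$, $L_K(\mathcal{G})$ is the (associative, not necessarily unital) $K$-algebra generated by $\{s_e,s_e^*\mid e\in\mathcal{G}^1\}\cup\{p_A\mid A\in\mathcal{G}^0\}$ subject to the relations, for all $A,B\in\mathcal{G}^0$, $e,f\in\mathcal{G}^1$: (1) $p_\varnothing=0$, $p_Ap_B=p_{A\cap B}$, $p_{A\cup B}=p_A+p_B-p_{A\cap B}$; (2) $p_{s(e)}s_e=s_e=s_ep_{r(e)}$ and $p_{r(e)}s_e^*=s_e^*=s_e^*p_{s(e)}$; (3) $s_e^*s_f=\delta_{e,f}p_{r(e)}$; (4) $p_v=\sum_{s(e)=v}s_es_e^*$ for every regular vertex $v$. Here $p_v:=p_{\{v\}}$, and $s_\alpha:=s_{\alpha_1}\cdots s_{\alpha_n}$ for a path $\alpha=\alpha_1\cdots\alpha_n$. *)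

theory Defs
  imports "HOL-Library.Poly_Mapping" "HOL-Library.Countable_Set"
begin

section \<open>Ultragraphs\<close>

record ('v, 'e) ultragraph =
  verts :: "'v set"
  edges :: "'e set"
  rng :: "'e \<Rightarrow> 'v set"
  src :: "'e \<Rightarrow> 'v"

definition is_ultragraph :: "('v, 'e) ultragraph \<Rightarrow> bool" where
  "is_ultragraph G \<longleftrightarrow>
     countable (verts G) \<and> countable (edges G) \<and>
     (\<forall>e\<in>edges G. src G e \<in> verts G) \<and>
     (\<forall>e\<in>edges G. rng G e \<subseteq> verts G \<and> rng G e \<noteq> {})"

definition out_edges :: "('v, 'e) ultragraph \<Rightarrow> 'v \<Rightarrow> 'e set" where
  "out_edges G v = {e \<in> edges G. src G e = v}"

definition regular_vertex :: "('v, 'e) ultragraph \<Rightarrow> 'v \<Rightarrow> bool" where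
  "regular_vertex G v \<longleftrightarrow> v \<in> verts G \<and> out_edges G v \<noteq> {} \<and> finite (out_edges G v)"

text \<open>The empty set is the empty finite union. It is also \<open>{v} - {v}\<close>, so the first rule
  matters only for the ultragraph without vertices.\<close>

inductive_set gen_verts :: "('v, 'e) ultragraph \<Rightarrow> 'v set set"
  for G :: "('v, 'e) ultragraph" where
  empty: "{} \<in> gen_verts G"
| vertex: "v \<in> verts G \<Longrightarrow> {v} \<in> gen_verts G"
| range: "e \<in> edges G \<Longrightarrow> rng G e \<in> gen_verts G"
| diff: "\<lbrakk>A \<in> gen_verts G; B \<in> gen_verts G\<rbrakk> \<Longrightarrow> A - B \<in> gen_verts G"
| union: "\<lbrakk>A \<in> gen_verts G; B \<in> gen_verts G\<rbrakk> \<Longrightarrow> A \<union> B \<in> gen_verts G"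
| inter: "\<lbrakk>A \<in> gen_verts G; B \<in> gen_verts G\<rbrakk> \<Longrightarrow> A \<inter> B \<in> gen_verts G"

text \<open>Paths of positive length, as lists of edges.\<close>

definition edge_path :: "('v, 'e) ultragraph \<Rightarrow> 'e list \<Rightarrow> bool" where
  "edge_path G c \<longleftrightarrow> c \<noteq> [] \<and> set c \<subseteq> edges G \<and>
     (\<forall>i. Suc i < length c \<longrightarrow> src G (c ! Suc i) \<in> rng G (c ! i))"

definition path_src :: "('v, 'e) ultragraph \<Rightarrow> 'e list \<Rightarrow> 'v" where
  "path_src G c = src G (hd c)"

definition path_rng :: "('v, 'e) ultragraph \<Rightarrow> 'e list \<Rightarrow> 'v set" where
  "path_rng G c = rng G (last c)"

definition closed_path_at :: "('v, 'e) ultragraph \<Rightarrow> 'v \<Rightarrow> 'e list \<Rightarrow> bool" where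
  "closed_path_at G v c \<longleftrightarrow> edge_path G c \<and> path_src G c = v \<and> v \<in> path_rng G c"

definition cycle_at :: "('v, 'e) ultragraph \<Rightarrow> 'v \<Rightarrow> 'e list \<Rightarrow> bool" where
  "cycle_at G v c \<longleftrightarrow> closed_path_at G v c \<and> distinct (map (src G) c)"


section \<open>Algebras without unit and their ideals\<close>

text \<open>\<open>HOL-Algebra\<close> only treats rings with a unit, which \<open>L\<^sub>K(\<G>)\<close> need not have.\<close>

record ('k, 'a) nualgebra =
  acarrier :: "'a set"
  azero :: 'a
  aadd :: "'a \<Rightarrow> 'a \<Rightarrow> 'a"
  amult :: "'a \<Rightarrow> 'a \<Rightarrow> 'a"
  ascale :: "'k \<Rightarrow> 'a \<Rightarrow> 'a"

text \<open>Ring ideals: closure under scalars is not required. In a Leavitt path algebra it is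
  automatic, because every element \<open>x\<close> satisfies \<open>x = p\<^sub>A x\<close> for some \<open>A\<close>.\<close>

definition two_sided_ideal :: "('k, 'a) nualgebra \<Rightarrow> 'a set \<Rightarrow> bool" where
  "two_sided_ideal L I \<longleftrightarrow>
     I \<subseteq> acarrier L \<and> azero L \<in> I \<and>
     (\<forall>x\<in>I. \<forall>y\<in>I. aadd L x y \<in> I) \<and>
     (\<forall>x\<in>I. \<exists>y\<in>I. aadd L x y = azero L) \<and>
     (\<forall>x\<in>I. \<forall>a\<in>acarrier L. amult L a x \<in> I \<and> amult L x a \<in> I)"

definition ideal_generated_by :: "('k, 'a) nualgebra \<Rightarrow> 'a set \<Rightarrow> 'a set" where
  "ideal_generated_by L X = \<Inter> {I. two_sided_ideal L I \<and> X \<subseteq> I}"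


section \<open>The free algebra on the generators\<close>

datatype ('v, 'e) lpa_gen = GenP "'v set" | GenS 'e | GenS' 'e

text \<open>The free monoid, written additively so that \<open>'a fmon \<Rightarrow>\<^sub>0 'k\<close> carries the convolution
  product of \<open>HOL-Library.Poly_Mapping\<close> and is the free unital associative algebra.\<close>

datatype 'a fmon = FMon (letters: "'a list")

instantiation fmon :: (type) monoid_add
begin

definition zero_fmon :: "'a fmon" where
  "zero_fmon = FMon []"

definition plus_fmon :: "'a fmon \<Rightarrow> 'a fmon \<Rightarrow> 'a fmon" where
  "plus_fmon u w = FMon (letters u @ letters w)"

instance
  by standard (auto simp: zero_fmon_def plus_fmon_def)

end

type_synonym ('v, 'e, 'k) free_alg = "('v, 'e) lpa_gen fmon \<Rightarrow>\<^sub>0 'k"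

definition gen :: "('v, 'e) lpa_gen \<Rightarrow> ('v, 'e, 'k::field) free_alg" where
  "gen x = Poly_Mapping.single (FMon [x]) 1"

abbreviation pf :: "'v set \<Rightarrow> ('v, 'e, 'k::field) free_alg" where
  "pf A \<equiv> gen (GenP A)"

abbreviation sf :: "'e \<Rightarrow> ('v, 'e, 'k::field) free_alg" where
  "sf e \<equiv> gen (GenS e)"

abbreviation sf' :: "'e \<Rightarrow> ('v, 'e, 'k::field) free_alg" where
  "sf' e \<equiv> gen (GenS' e)"

definition sf_path :: "'e list \<Rightarrow> ('v, 'e, 'k::field) free_alg" where
  "sf_path c = prod_list (map sf c)"

definition scale :: "'k \<Rightarrow> ('v, 'e, 'k::field) free_alg \<Rightarrow> ('v, 'e, 'k) free_alg" where
  "scale k x = Poly_Mapping.map ((*) k) x"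

definition generators :: "('v, 'e) ultragraph \<Rightarrow> ('v, 'e) lpa_gen set" where
  "generators G = GenP ` gen_verts G \<union> GenS ` edges G \<union> GenS' ` edges G"

text \<open>The free non-unital algebra on the generators: combinations of nonempty words.\<close>

definition free_carrier :: "('v, 'e) ultragraph \<Rightarrow> ('v, 'e, 'k::field) free_alg set" where
  "free_carrier G =
     {x. \<forall>w\<in>Poly_Mapping.keys x. letters w \<noteq> [] \<and> set (letters w) \<subseteq> generators G}"


section \<open>The ultragraph Leavitt path algebra\<close>

text \<open>A relation \<open>l = r\<close> is recorded as the element \<open>l - r\<close>.\<close>

inductive_set relators :: "('v, 'e) ultragraph \<Rightarrow> ('v, 'e, 'k::field) free_alg set"
  for G :: "('v, 'e) ultragraph" where
  empty: "pf {} \<in> relators G"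
| inter: "\<lbrakk>A \<in> gen_verts G; B \<in> gen_verts G\<rbrakk> \<Longrightarrow> pf A * pf B - pf (A \<inter> B) \<in> relators G"
| union: "\<lbrakk>A \<in> gen_verts G; B \<in> gen_verts G\<rbrakk> \<Longrightarrow>
    pf (A \<union> B) - (pf A + pf B - pf (A \<inter> B)) \<in> relators G"
| src_s: "e \<in> edges G \<Longrightarrow> pf {src G e} * sf e - sf e \<in> relators G"
| s_rng: "e \<in> edges G \<Longrightarrow> sf e * pf (rng G e) - sf e \<in> relators G"
| rng_s': "e \<in> edges G \<Longrightarrow> pf (rng G e) * sf' e - sf' e \<in> relators G"
| s'_src: "e \<in> edges G \<Longrightarrow> sf' e * pf {src G e} - sf' e \<in> relators G"
| ck1: "\<lbrakk>e \<in> edges G; f \<in> edges G\<rbrakk> \<Longrightarrow>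
    sf' e * sf f - (if e = f then pf (rng G e) else 0) \<in> relators G"
| ck2: "regular_vertex G v \<Longrightarrow>
    pf {v} - (\<Sum>e\<in>out_edges G v. sf e * sf' e) \<in> relators G"

inductive_set relation_ideal :: "('v, 'e) ultragraph \<Rightarrow> ('v, 'e, 'k::field) free_alg set"
  for G :: "('v, 'e) ultragraph" where
  relator: "x \<in> relators G \<Longrightarrow> x \<in> relation_ideal G"
| zero: "0 \<in> relation_ideal G"
| add: "\<lbrakk>x \<in> relation_ideal G; y \<in> relation_ideal G\<rbrakk> \<Longrightarrow> x + y \<in> relation_ideal G"
| scale: "x \<in> relation_ideal G \<Longrightarrow> scale k x \<in> relation_ideal G"
| left: "\<lbrakk>x \<in> relation_ideal G; a \<in> free_carrier G\<rbrakk> \<Longrightarrow> a * x \<in> relation_ideal G"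
| right: "\<lbrakk>x \<in> relation_ideal G; a \<in> free_carrier G\<rbrakk> \<Longrightarrow> x * a \<in> relation_ideal G"

definition lpa_class ::
    "('v, 'e) ultragraph \<Rightarrow> ('v, 'e, 'k::field) free_alg \<Rightarrow> ('v, 'e, 'k) free_alg set" where
  "lpa_class G x = {y \<in> free_carrier G. y - x \<in> relation_ideal G}"

definition LPA ::
    "('v, 'e) ultragraph \<Rightarrow> ('k::field, ('v, 'e, 'k) free_alg set) nualgebra" where
  "LPA G =
     \<lparr>acarrier = lpa_class G ` free_carrier G,
      azero = lpa_class G 0,
      aadd = (\<lambda>X Y. \<Union>x\<in>X. \<Union>y\<in>Y. lpa_class G (x + y)),
      amult = (\<lambda>X Y. \<Union>x\<in>X. \<Union>y\<in>Y. lpa_class G (x * y)),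
      ascale = (\<lambda>k X. \<Union>x\<in>X. lpa_class G (scale k x))\<rparr>"


subsection \<open>The operations are well defined\<close>

lemma scale_eq: "scale k x = Poly_Mapping.single 0 k * x"
  by (simp add: scale_def mult_map_scale_conv_mult)

lemma free_carrier_0: "0 \<in> free_carrier G"
  by (simp add: free_carrier_def)

lemma free_carrier_add:
  "\<lbrakk>x \<in> free_carrier G; y \<in> free_carrier G\<rbrakk> \<Longrightarrow> x + y \<in> free_carrier G"
  using keys_add[of x y] unfolding free_carrier_def by blast

lemma free_carrier_scale: "x \<in> free_carrier G \<Longrightarrow> scale k x \<in> free_carrier G"
  using keys_mult[of "Poly_Mapping.single 0 k" x]
  by (auto simp: free_carrier_def scale_eq split: if_splits)

lemma free_carrier_mult:
  assumes "x \<in> free_carrier G" "y \<in> free_carrier G"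
  shows "x * y \<in> free_carrier G"
proof -
  have "letters w \<noteq> [] \<and> set (letters w) \<subseteq> generators G" if w: "w \<in> Poly_Mapping.keys (x * y)" for w
  proof -
    obtain a b where "w = a + b" "a \<in> Poly_Mapping.keys x" "b \<in> Poly_Mapping.keys y"
      using subsetD[OF keys_mult w] by blast
    then show ?thesis
      using assms by (auto simp: free_carrier_def plus_fmon_def)
  qed
  then show ?thesis by (simp add: free_carrier_def)
qed

lemma scale_minus_one: "scale (-1) x = - x"
  by (simp add: scale_eq single_uminus)

lemma free_carrier_uminus: "x \<in> free_carrier G \<Longrightarrow> - x \<in> free_carrier G"
  using free_carrier_scale[of x G "-1"] by (simp add: scale_minus_one)

lemma free_carrier_diff:
  "\<lbrakk>x \<in> free_carrier G; y \<in> free_carrier G\<rbrakk> \<Longrightarrow> x - y \<in> free_carrier G"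
  using free_carrier_add[of x G "- y"] by (simp add: free_carrier_uminus)

lemma free_carrier_sum:
  "(\<And>i. i \<in> S \<Longrightarrow> f i \<in> free_carrier G) \<Longrightarrow> sum f S \<in> free_carrier G"
  by (induction S rule: infinite_finite_induct) (auto simp: free_carrier_0 free_carrier_add)

lemma free_carrier_gen: "x \<in> generators G \<Longrightarrow> gen x \<in> free_carrier G"
  by (simp add: gen_def free_carrier_def)

lemma free_carrier_gens:
  "A \<in> gen_verts G \<Longrightarrow> pf A \<in> free_carrier G"
  "e \<in> edges G \<Longrightarrow> sf e \<in> free_carrier G"
  "e \<in> edges G \<Longrightarrow> sf' e \<in> free_carrier G"
  by (auto intro!: free_carrier_gen simp: generators_def)

lemma relators_free_carrier:
  assumes "is_ultragraph G" "x \<in> relators G"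
  shows "x \<in> free_carrier G"
  using assms(2,1)
proof induction
  case (ck2 v)
  then show ?case
    by (intro free_carrier_diff free_carrier_sum free_carrier_mult free_carrier_gens
        gen_verts.vertex) (auto simp: regular_vertex_def out_edges_def)
qed (simp_all add: is_ultragraph_def free_carrier_gens free_carrier_diff free_carrier_add
    free_carrier_mult free_carrier_0 gen_verts.intros)

lemma relation_ideal_free_carrier:
  assumes "is_ultragraph G" "x \<in> relation_ideal G"
  shows "x \<in> free_carrier G"
  using assms(2)
  by induction
    (auto intro: relators_free_carrier[OF assms(1)] free_carrier_0 free_carrier_add
      free_carrier_scale free_carrier_mult)

lemma relation_ideal_uminus: "x \<in> relation_ideal G \<Longrightarrow> - x \<in> relation_ideal G"
  using relation_ideal.scale[of x G "-1"] by (simp add: scale_minus_one)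

lemma relation_ideal_diff:
  "\<lbrakk>x \<in> relation_ideal G; y \<in> relation_ideal G\<rbrakk> \<Longrightarrow> x - y \<in> relation_ideal G"
  using relation_ideal.add[of x G "- y"] by (simp add: relation_ideal_uminus)

lemma lpa_class_self: "x \<in> free_carrier G \<Longrightarrow> x \<in> lpa_class G x"
  by (simp add: lpa_class_def relation_ideal.zero)

lemma lpa_class_eqI:
  assumes "x - y \<in> relation_ideal G"
  shows "lpa_class G x = lpa_class G y"
proof -
  have "z - y \<in> relation_ideal G" if "z - x \<in> relation_ideal G" for z
    using relation_ideal.add[OF that assms] by simp
  moreover have "z - x \<in> relation_ideal G" if "z - y \<in> relation_ideal G" for z
    using relation_ideal_diff[OF that assms] by simp
  ultimately show ?thesis
    unfolding lpa_class_def by blast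
qed

lemma lpa_class_eq_iff:
  assumes "x \<in> free_carrier G"
  shows "lpa_class G x = lpa_class G y \<longleftrightarrow> x - y \<in> relation_ideal G"
proof
  assume "lpa_class G x = lpa_class G y"
  then have "x \<in> lpa_class G y"
    using lpa_class_self[OF assms] by simp
  then show "x - y \<in> relation_ideal G"
    by (simp add: lpa_class_def)
qed (rule lpa_class_eqI)

lemma lpa_class_relator: "x \<in> relators G \<Longrightarrow> lpa_class G x = azero (LPA G)"
  unfolding LPA_def by (simp add: lpa_class_eqI relation_ideal.relator)

lemma LPA_add:
  assumes "x \<in> free_carrier G" "y \<in> free_carrier G"
  shows "aadd (LPA G) (lpa_class G x) (lpa_class G y) = lpa_class G (x + y)"
proof -
  have "lpa_class G (a + b) = lpa_class G (x + y)"
    if "a \<in> lpa_class G x" "b \<in> lpa_class G y" for a b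
  proof (rule lpa_class_eqI)
    have "(a - x) + (b - y) \<in> relation_ideal G"
      using that by (simp add: lpa_class_def relation_ideal.add)
    then show "a + b - (x + y) \<in> relation_ideal G" by (simp add: algebra_simps)
  qed
  then have "(\<Union>a\<in>lpa_class G x. \<Union>b\<in>lpa_class G y. lpa_class G (a + b)) =
      (\<Union>a\<in>lpa_class G x. \<Union>b\<in>lpa_class G y. lpa_class G (x + y))"
    by (intro SUP_cong refl)
  moreover have "lpa_class G x \<noteq> {}" "lpa_class G y \<noteq> {}"
    using assms[THEN lpa_class_self] by blast+
  ultimately show ?thesis
    by (simp add: LPA_def)
qed

lemma LPA_mult:
  assumes "x \<in> free_carrier G" "y \<in> free_carrier G"
  shows "amult (LPA G) (lpa_class G x) (lpa_class G y) = lpa_class G (x * y)"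
proof -
  have "lpa_class G (a * b) = lpa_class G (x * y)"
    if "a \<in> lpa_class G x" "b \<in> lpa_class G y" for a b
  proof (rule lpa_class_eqI)
    have "(a - x) * b + x * (b - y) \<in> relation_ideal G"
      using that assms
      by (intro relation_ideal.add relation_ideal.left relation_ideal.right)
        (simp_all add: lpa_class_def)
    then show "a * b - x * y \<in> relation_ideal G" by (simp add: algebra_simps)
  qed
  then have "(\<Union>a\<in>lpa_class G x. \<Union>b\<in>lpa_class G y. lpa_class G (a * b)) =
      (\<Union>a\<in>lpa_class G x. \<Union>b\<in>lpa_class G y. lpa_class G (x * y))"
    by (intro SUP_cong refl)
  moreover have "lpa_class G x \<noteq> {}" "lpa_class G y \<noteq> {}"
    using assms[THEN lpa_class_self] by blast+
  ultimately show ?thesis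
    by (simp add: LPA_def)
qed

lemma LPA_scale:
  assumes "x \<in> free_carrier G"
  shows "ascale (LPA G) k (lpa_class G x) = lpa_class G (scale k x)"
proof -
  have "lpa_class G (scale k a) = lpa_class G (scale k x)" if "a \<in> lpa_class G x" for a
  proof (rule lpa_class_eqI)
    have "scale k (a - x) \<in> relation_ideal G"
      using that by (simp add: lpa_class_def relation_ideal.scale)
    then show "scale k a - scale k x \<in> relation_ideal G"
      by (simp add: scale_eq right_diff_distrib)
  qed
  then have "(\<Union>a\<in>lpa_class G x. lpa_class G (scale k a)) =
      (\<Union>a\<in>lpa_class G x. lpa_class G (scale k x))"
    by (intro SUP_cong refl)
  moreover have "lpa_class G x \<noteq> {}"
    using lpa_class_self[OF assms] by blast
  ultimately show ?thesis
    by (simp add: LPA_def)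
qed

end

theory Submission
  imports Defs "HOL.Modules"
begin

text \<open>Let \<open>J \<subseteq> I\<close> be the ideal generated by the special elements of \<open>I\<close>. Write \<open>x \<in> I\<close> as a
  combination of terms \<open>s\<^sub>\<alpha> p\<^sub>A s\<^sub>\<beta>\<^sup>*\<close> and induct on the length of the ghost paths \<open>\<beta>\<close>:
  multiplying by \<open>s\<^sub>e\<close> on the right shortens them, and what is left of \<open>x p\<^sub>v\<close> is \<open>x q\<close> with
  \<open>q = p\<^sub>v - (\<Sum>e\<in>F. s\<^sub>e s\<^sub>e\<^sup>*)\<close>, where \<open>x\<close> may be replaced by an element without ghost edges.
  For an element of \<open>I\<close> without ghost edges, cutting the sets \<open>A\<close> into pieces and stripping edges
  from the left leads to elements \<open>k p\<^sub>w + (\<Sum>\<alpha>. k\<^sub>\<alpha> s\<^sub>\<alpha> p\<^sub>w)\<close> with \<open>k \<noteq> 0\<close> and closed paths \<open>\<alpha>\<close> at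
  a single vertex \<open>w\<close>. If there are two different first return paths \<open>a\<close> and \<open>b\<close> at \<open>w\<close>, conjugation
  by \<open>a\<^sup>N b\<close> gives \<open>p\<^sub>w \<in> I\<close>. Otherwise the closed paths at \<open>w\<close> are the powers of one cycle, the
  only cycle at \<open>w\<close>, and the element is special up to a scalar. Apart from the elements \<open>p\<^sub>A\<close>, only
  special elements with \<open>A = {v}\<close> are needed.\<close>


section \<open>Closed paths\<close>

lemma edge_path_Cons:
  "edge_path G (e # p) \<longleftrightarrow>
     e \<in> edges G \<and> (p \<noteq> [] \<longrightarrow> edge_path G p \<and> src G (hd p) \<in> rng G e)"
proof (cases p)
  case (Cons f p')
  have "(\<forall>i. Suc i < length (e # p) \<longrightarrow> src G ((e # p) ! Suc i) \<in> rng G ((e # p) ! i)) \<longleftrightarrow>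
      src G f \<in> rng G e \<and> (\<forall>i. Suc i < length p \<longrightarrow> src G (p ! Suc i) \<in> rng G (p ! i))"
    using Cons by (auto simp: less_Suc_eq_0_disj nth_Cons split: nat.split)
  then show ?thesis
    using Cons by (auto simp: edge_path_def)
qed (simp add: edge_path_def)

lemma edge_path_append:
  assumes "p \<noteq> []" "p' \<noteq> []"
  shows "edge_path G (p @ p') \<longleftrightarrow>
     edge_path G p \<and> edge_path G p' \<and> src G (hd p') \<in> rng G (last p)"
  using assms by (induction p) (auto simp: edge_path_Cons)

lemma closed_path_edges: "closed_path_at G w p \<Longrightarrow> set p \<subseteq> edges G"
  by (simp add: closed_path_at_def edge_path_def)

text \<open>In an ultragraph a first return path may be a prefix of another one, since the range of
  its last edge can contain further vertices besides \<open>w\<close>.\<close>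

definition first_return :: "('v, 'e) ultragraph \<Rightarrow> 'v \<Rightarrow> 'e list \<Rightarrow> bool" where
  "first_return G w p \<longleftrightarrow> closed_path_at G w p \<and> (\<forall>e\<in>set (tl p). src G e \<noteq> w)"

text \<open>Cut the path before every edge with source \<open>w\<close>. Each piece is closed,
  because the edge after it starts at \<open>w\<close>, so that \<open>w\<close> lies in the range
  of its last edge.\<close>

lemma closed_path_concat_first_returns:
  assumes "closed_path_at G w p"
  shows "\<exists>ws. ws \<noteq> [] \<and> (\<forall>x\<in>set ws. first_return G w x) \<and> p = concat ws"
  using assms
proof (induction p rule: length_induct)
  case (1 p)
  then have p: "closed_path_at G w p" by blast
  then obtain e p1 where e: "p = e # p1" "src G e = w"
    by (cases p) (auto simp: closed_path_at_def edge_path_def path_src_def)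
  define x where "x = e # takeWhile (\<lambda>f. src G f \<noteq> w) p1"
  define p' where "p' = dropWhile (\<lambda>f. src G f \<noteq> w) p1"
  have split: "p = x @ p'" by (simp add: x_def p'_def e)
  have tl: "\<forall>f\<in>set (tl x). src G f \<noteq> w"
    by (auto simp: x_def dest: set_takeWhileD)
  show ?case
  proof (cases "p' = []")
    case True
    then have "first_return G w p"
      using p tl split by (simp add: first_return_def)
    then show ?thesis by (intro exI[of _ "[p]"]) simp
  next
    case False
    then have src: "src G (hd p') = w"
      unfolding p'_def using hd_dropWhile[of "\<lambda>f. src G f \<noteq> w" p1] by blast
    have "x \<noteq> []" by (simp add: x_def)
    then have "edge_path G x" "edge_path G p'" "w \<in> rng G (last x)"
      using p src edge_path_append[of x p' G] False split by (auto simp: closed_path_at_def)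
    then have "first_return G w x" "closed_path_at G w p'"
      using p src tl False split e
      by (auto simp: first_return_def closed_path_at_def path_src_def path_rng_def x_def)
    moreover have "length p' < length p"
      using split \<open>x \<noteq> []\<close> by simp
    ultimately obtain ws where "ws \<noteq> []" "\<forall>x\<in>set ws. first_return G w x" "p' = concat ws"
      using "1.IH" by blast
    then show ?thesis
      using \<open>first_return G w x\<close> split by (intro exI[of _ "x # ws"]) simp
  qed
qed

text \<open>Distinct sources prevent a second visit to \<open>w\<close>. Hence a unique first return
  path at \<open>w\<close> makes the cycle at \<open>w\<close> unique as well.\<close>

lemma cycle_first_return:
  assumes "cycle_at G w p"
  shows "first_return G w p"
proof (cases p)
  case (Cons e p1)
  then show ?thesis
    using assms
    by (auto simp: cycle_at_def first_return_def closed_path_at_def path_src_def image_iff)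
qed (use assms in \<open>simp add: cycle_at_def closed_path_at_def edge_path_def\<close>)

text \<open>Cutting out the piece between two edges with the same source gives a shorter first return
  path.\<close>

lemma unique_first_return_cycle:
  assumes c: "first_return G w c" and unique: "\<And>d. first_return G w d \<Longrightarrow> d = c"
  shows "cycle_at G w c"
proof -
  have "distinct (map (src G) c)"
  proof (rule ccontr)
    assume "\<not> distinct (map (src G) c)"
    then obtain xs ys zs y where "map (src G) c = xs @ [y] @ ys @ [y] @ zs"
      using not_distinct_decomp by blast
    then obtain c1 e c2 f c3 where c_eq: "c = c1 @ e # c2 @ f # c3" and ef: "src G e = src G f"
      by (auto simp: map_eq_append_conv append_eq_map_conv map_eq_Cons_conv Cons_eq_map_conv)
    define d where "d = c1 @ f # c3"
    have "c1 \<noteq> []"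
      using c ef by (auto simp: c_eq first_return_def closed_path_at_def path_src_def)
    have "edge_path G (c1 @ (e # c2 @ f # c3))"
      using c c_eq by (simp add: first_return_def closed_path_at_def)
    then have c1: "edge_path G c1" "src G f \<in> rng G (last c1)" and "edge_path G ((e # c2) @ (f # c3))"
      using edge_path_append[OF \<open>c1 \<noteq> []\<close>, of "e # c2 @ f # c3" G] ef by auto
    then have "edge_path G (f # c3)"
      using edge_path_append[of "e # c2" "f # c3" G] by auto
    then have "edge_path G d"
      using c1 edge_path_append[OF \<open>c1 \<noteq> []\<close>, of "f # c3" G] by (simp add: d_def)
    then have "first_return G w d"
      using c \<open>c1 \<noteq> []\<close>
      by (auto simp: first_return_def closed_path_at_def path_src_def path_rng_def c_eq d_def)
    then show False
      using unique[of d] by (simp add: c_eq d_def)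
  qed
  then show ?thesis
    using c by (simp add: cycle_at_def first_return_def)
qed


section \<open>Rings satisfying the relations\<close>

lemma gen_verts_subset:
  assumes "is_ultragraph G" "A \<in> gen_verts G"
  shows "A \<subseteq> verts G"
  using assms(2) by induction (use assms(1) in \<open>auto simp: is_ultragraph_def\<close>)

text \<open>Splitting \<open>C\<close> into \<open>B \<inter> A\<close> and \<open>B - A\<close> for
  one \<open>A\<close> after another ends in pieces that every \<open>A\<close> either contains or
  misses. A property that is additive over disjoint unions then passes from the pieces to
  \<open>C\<close>.\<close>

lemma gen_verts_pure_induct:
  assumes "finite \<A>" "\<A> \<subseteq> gen_verts G" "C \<in> gen_verts G"
    and union: "\<And>A B. \<lbrakk>A \<in> gen_verts G; B \<in> gen_verts G; A \<inter> B = {}; \<Phi> A; \<Phi> B\<rbrakk> \<Longrightarrow> \<Phi> (A \<union> B)"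
    and pure: "\<And>B. \<lbrakk>B \<in> gen_verts G; \<forall>A\<in>\<A>. B \<subseteq> A \<or> B \<inter> A = {}\<rbrakk> \<Longrightarrow> \<Phi> B"
  shows "\<Phi> C"
  using assms(1,2,3) pure
proof (induction \<A> arbitrary: C rule: finite_induct)
  case (insert A \<A>)
  have "\<Phi> B" if B: "B \<in> gen_verts G" "\<forall>A\<in>\<A>. B \<subseteq> A \<or> B \<inter> A = {}" for B
  proof -
    have "\<Phi> (B \<inter> A)" "\<Phi> (B - A)"
      using B insert.prems(1) by (intro insert.prems(3) gen_verts.inter gen_verts.diff; auto)+
    then have "\<Phi> ((B \<inter> A) \<union> (B - A))"
      using B insert.prems(1) by (intro union gen_verts.inter gen_verts.diff) auto
    moreover have "(B \<inter> A) \<union> (B - A) = B" by auto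
    ultimately show ?thesis by simp
  qed
  then show ?case
    using insert.IH insert.prems by auto
qed auto

text \<open>The images of the generators in a ring whose product is bilinear over the field. The
  ring may be larger than the subalgebra that they generate, which is why the latter is described by
  spans and why ideals are replaced by \<open>absorbing\<close> subspaces.\<close>

locale lpa_family = module sm
  for sm :: "'k::field \<Rightarrow> 'a::ring \<Rightarrow> 'a" (infixr "*s" 75) +
  fixes G :: "('v, 'e) ultragraph" and P :: "'v set \<Rightarrow> 'a" and S S' :: "'e \<Rightarrow> 'a"
  assumes ultragraph: "is_ultragraph G"
    and sm_mult_left: "(k *s x) * y = k *s (x * y)"
    and sm_mult_right: "x * (k *s y) = k *s (x * y)"
    and P_empty: "P {} = 0"
    and P_P: "\<lbrakk>A \<in> gen_verts G; B \<in> gen_verts G\<rbrakk> \<Longrightarrow> P A * P B = P (A \<inter> B)"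
    and P_Un: "\<lbrakk>A \<in> gen_verts G; B \<in> gen_verts G\<rbrakk> \<Longrightarrow> P (A \<union> B) = P A + P B - P (A \<inter> B)"
    and P_src_S: "e \<in> edges G \<Longrightarrow> P {src G e} * S e = S e"
    and S_P_rng: "e \<in> edges G \<Longrightarrow> S e * P (rng G e) = S e"
    and P_rng_S': "e \<in> edges G \<Longrightarrow> P (rng G e) * S' e = S' e"
    and S'_P_src: "e \<in> edges G \<Longrightarrow> S' e * P {src G e} = S' e"
    and S'_S: "\<lbrakk>e \<in> edges G; f \<in> edges G\<rbrakk> \<Longrightarrow> S' e * S f = (if e = f then P (rng G e) else 0)"
begin

lemma src_gen_verts: "e \<in> edges G \<Longrightarrow> {src G e} \<in> gen_verts G"
  using ultragraph by (auto simp: is_ultragraph_def intro: gen_verts.vertex)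

lemma vertex_gen_verts: "w \<in> A \<Longrightarrow> A \<in> gen_verts G \<Longrightarrow> {w} \<in> gen_verts G"
  using gen_verts_subset[OF ultragraph] by (auto intro: gen_verts.vertex)

lemmas gv = gen_verts.empty gen_verts.vertex gen_verts.range gen_verts.diff gen_verts.union
  gen_verts.inter src_gen_verts

lemma P_S:
  assumes "A \<in> gen_verts G" "e \<in> edges G"
  shows "P A * S e = (if src G e \<in> A then S e else 0)"
proof -
  have "P A * S e = P A * P {src G e} * S e"
    by (simp only: mult.assoc P_src_S[OF assms(2)])
  then show ?thesis
    using assms by (simp add: P_P gv P_src_S P_empty)
qed

lemma S'_P:
  assumes "A \<in> gen_verts G" "e \<in> edges G"
  shows "S' e * P A = (if src G e \<in> A then S' e else 0)"
proof -
  have "S' e * P A = S' e * (P {src G e} * P A)"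
    by (simp only: mult.assoc[symmetric] S'_P_src[OF assms(2)])
  then show ?thesis
    using assms by (simp add: P_P gv S'_P_src P_empty)
qed

lemma P_P_assoc:
  "\<lbrakk>A \<in> gen_verts G; B \<in> gen_verts G\<rbrakk> \<Longrightarrow> P A * (P B * x) = P (A \<inter> B) * x"
  by (simp add: mult.assoc[symmetric] P_P)

lemma P_S_assoc:
  "\<lbrakk>A \<in> gen_verts G; e \<in> edges G\<rbrakk> \<Longrightarrow> P A * (S e * x) = (if src G e \<in> A then S e * x else 0)"
  by (simp add: mult.assoc[symmetric] P_S)

lemma S'_P_assoc:
  "\<lbrakk>A \<in> gen_verts G; e \<in> edges G\<rbrakk> \<Longrightarrow> S' e * (P A * x) = (if src G e \<in> A then S' e * x else 0)"
  by (simp add: mult.assoc[symmetric] S'_P)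

lemma S_P_rng_assoc: "e \<in> edges G \<Longrightarrow> S e * (P (rng G e) * x) = S e * x"
  by (simp add: mult.assoc[symmetric] S_P_rng)

lemma P_rng_S'_assoc: "e \<in> edges G \<Longrightarrow> P (rng G e) * (S' e * x) = S' e * x"
  by (simp add: mult.assoc[symmetric] P_rng_S')

lemma S'_S_assoc:
  "\<lbrakk>e \<in> edges G; f \<in> edges G\<rbrakk> \<Longrightarrow> S' e * (S f * x) = (if e = f then P (rng G e) * x else 0)"
  by (simp add: mult.assoc[symmetric] S'_S)

lemmas rel = P_P P_P_assoc P_S P_S_assoc S'_P S'_P_assoc S_P_rng S_P_rng_assoc P_rng_S'
  P_rng_S'_assoc S'_S S'_S_assoc gv P_empty

lemma P_disjoint_Un:
  "\<lbrakk>A \<in> gen_verts G; B \<in> gen_verts G; A \<inter> B = {}\<rbrakk> \<Longrightarrow> P (A \<union> B) = P A + P B"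
  by (simp add: P_Un P_empty)

text \<open>Isolates the vertices at which finitely many given edges start. What remains of
  \<open>C\<close> annihilates those edges from the left.\<close>

lemma P_remove_finite:
  assumes "finite W" "W \<subseteq> C" "C \<in> gen_verts G"
  shows "C - W \<in> gen_verts G \<and> P C = P (C - W) + (\<Sum>w\<in>W. P {w})"
  using assms
proof (induction W rule: finite_induct)
  case (insert w W)
  then have IH: "C - W \<in> gen_verts G" "P C = P (C - W) + (\<Sum>w\<in>W. P {w})" by auto
  have w: "{w} \<in> gen_verts G"
    using insert.prems by (auto intro: vertex_gen_verts)
  have eq: "C - insert w W = (C - W) - {w}" "C - W = (C - insert w W) \<union> {w}"
    using insert.prems insert.hyps by auto
  have gvw: "C - insert w W \<in> gen_verts G"
    unfolding eq(1) using IH(1) w by (rule gen_verts.diff)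
  have "P (C - W) = P (C - insert w W) + P {w}"
    using P_disjoint_Un[OF gvw w] by (simp only: eq(2)[symmetric]) simp
  then show ?case
    using IH gvw insert.hyps by (simp add: algebra_simps)
qed simp

section \<open>Spans of path terms and their lengths\<close>

lemma span_image:
  assumes "x \<in> span X" "subspace Y"
    and "\<And>a b. f (a + b) = f a + f b" "\<And>k a. f (k *s a) = k *s f a"
    and "\<And>y. y \<in> X \<Longrightarrow> f y \<in> Y"
  shows "f x \<in> Y"
  using assms(1)
proof (induction rule: span_induct_alt)
  case base
  have "f 0 = 0" using assms(4)[of 0 0] by simp
  then show ?case using assms(2) by (simp add: subspace_0)
next
  case (step c x y)
  then show ?case
    using assms by (simp add: subspace_add subspace_scale)
qed

lemmas span_image_left = span_image[of _ _ _ "\<lambda>x. a * x" for a,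
    OF _ _ distrib_left sm_mult_right, simplified]
lemmas span_image_right = span_image[of _ _ _ "\<lambda>x. x * a" for a,
    OF _ _ distrib_right sm_mult_left, simplified]

text \<open>Ending the product in \<open>P A\<close> gives the empty path a value without a unit in
  the ring.\<close>

definition sp :: "'e list \<Rightarrow> 'v set \<Rightarrow> 'a" where
  "sp p A = foldr (\<lambda>e y. S e * y) p (P A)"

text \<open>The fold puts the first edge of \<open>p\<close> at the right end, so this is
  \<open>P A\<close> times the ghost path \<beta>* of \<beta> = \<open>p\<close>.\<close>

definition ps :: "'v set \<Rightarrow> 'e list \<Rightarrow> 'a" where
  "ps A p = foldr (\<lambda>e y. y * S' e) p (P A)"

lemma sp_simps: "sp [] A = P A" "sp (e # p) A = S e * sp p A"
  by (simp_all add: sp_def)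

lemma ps_simps: "ps A [] = P A" "ps A (e # p) = ps A p * S' e"
  by (simp_all add: ps_def)

lemma sp_P:
  "\<lbrakk>set p \<subseteq> edges G; A \<in> gen_verts G; B \<in> gen_verts G\<rbrakk> \<Longrightarrow> sp p A * P B = sp p (A \<inter> B)"
  by (induction p) (simp_all add: sp_simps P_P mult.assoc)

lemma P_sp_Cons:
  "\<lbrakk>e \<in> edges G; B \<in> gen_verts G\<rbrakk> \<Longrightarrow> P B * sp (e # p) A = (if src G e \<in> B then sp (e # p) A else 0)"
  by (simp add: sp_simps P_S_assoc)

lemma ps_Cons_P:
  "\<lbrakk>e \<in> edges G; B \<in> gen_verts G\<rbrakk> \<Longrightarrow> ps A (e # p) * P B = (if src G e \<in> B then ps A (e # p) else 0)"
  by (simp add: ps_simps mult.assoc S'_P)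

lemma sp_S:
  "\<lbrakk>set p \<subseteq> edges G; A \<in> gen_verts G; e \<in> edges G\<rbrakk> \<Longrightarrow>
    sp p A * S e = (if src G e \<in> A then sp (p @ [e]) (rng G e) else 0)"
  by (induction p) (simp_all add: sp_simps P_S S_P_rng mult.assoc)

text \<open>The strict bound makes \<open>real_part 0\<close> trivial, so that inductions on
  \<open>n\<close> start from the zero element.\<close>

definition real_part :: "nat \<Rightarrow> 'a set" where
  "real_part n = span {sp p A |p A. set p \<subseteq> edges G \<and> A \<in> gen_verts G \<and> length p < n}"

definition pos_part :: "nat \<Rightarrow> 'a set" where
  "pos_part n =
     span {sp p A |p A. p \<noteq> [] \<and> set p \<subseteq> edges G \<and> A \<in> gen_verts G \<and> length p < n}"

text \<open>Only the ghost path is bounded, and not strictly: at \<open>n = 0\<close> the elements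
  without ghost edges remain, with real paths of any length.\<close>

definition ghost_part :: "nat \<Rightarrow> 'a set" where
  "ghost_part n = span {sp p A * ps B r |p A B r. set p \<subseteq> edges G \<and> set r \<subseteq> edges G \<and>
     A \<in> gen_verts G \<and> B \<in> gen_verts G \<and> length r \<le> n}"

lemma subspace_parts: "subspace (real_part n)" "subspace (pos_part n)" "subspace (ghost_part n)"
  by (simp_all add: real_part_def pos_part_def ghost_part_def)

lemma sp_real: "\<lbrakk>set p \<subseteq> edges G; A \<in> gen_verts G; length p < n\<rbrakk> \<Longrightarrow> sp p A \<in> real_part n"
  unfolding real_part_def by (rule span_base) auto

lemma sp_pos:
  "\<lbrakk>p \<noteq> []; set p \<subseteq> edges G; A \<in> gen_verts G; length p < n\<rbrakk> \<Longrightarrow> sp p A \<in> pos_part n"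
  unfolding pos_part_def by (rule span_base) auto

lemma real_part_0: "real_part 0 = {0}"
  by (simp add: real_part_def)

lemma real_part_mono: "m \<le> n \<Longrightarrow> real_part m \<subseteq> real_part n"
  unfolding real_part_def by (rule span_mono) fastforce

lemma real_part_P: "x \<in> real_part n \<Longrightarrow> B \<in> gen_verts G \<Longrightarrow> x * P B \<in> real_part n"
  by (rule span_image_right[OF _ subspace_parts(1)], subst (asm) real_part_def, assumption)
    (auto simp: sp_P intro!: sp_real gv)

lemma pos_part_P: "x \<in> pos_part n \<Longrightarrow> B \<in> gen_verts G \<Longrightarrow> x * P B \<in> pos_part n"
  by (rule span_image_right[OF _ subspace_parts(2)], subst (asm) pos_part_def, assumption)
    (auto simp: sp_P intro!: sp_pos gv)

lemma P_pos_part: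
  assumes "x \<in> pos_part n" "B \<in> gen_verts G"
  shows "P B * x \<in> pos_part n"
proof (rule span_image_left[OF assms(1)[unfolded pos_part_def] subspace_parts(2)])
  fix y assume "y \<in> {sp p A |p A. p \<noteq> [] \<and> set p \<subseteq> edges G \<and> A \<in> gen_verts G \<and> length p < n}"
  then obtain p A where p: "y = sp p A" "p \<noteq> []" "set p \<subseteq> edges G" "A \<in> gen_verts G" "length p < n"
    by blast
  then show "P B * y \<in> pos_part n"
    using assms(2) sp_pos[of p A n]
    by (cases p) (auto simp: P_sp_Cons subspace_0[OF subspace_parts(2)])
qed

text \<open>The ghost edge cancels the first edge of a term or kills the term. The paths get shorter
  by one, which drives the inductions on length.\<close>

lemma S'_pos_part:
  assumes "x \<in> pos_part (Suc n)" "e \<in> edges G"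
  shows "S' e * x \<in> real_part n"
proof (rule span_image_left[OF assms(1)[unfolded pos_part_def] subspace_parts(1)])
  fix y assume "y \<in> {sp p A |p A. p \<noteq> [] \<and> set p \<subseteq> edges G \<and> A \<in> gen_verts G \<and> length p < Suc n}"
  then obtain p A where p: "y = sp p A" "p \<noteq> []" "set p \<subseteq> edges G" "A \<in> gen_verts G"
      "length p < Suc n"
    by blast
  then obtain f r where f: "p = f # r" by (cases p) auto
  have "P (rng G e) * sp r A \<in> real_part n"
  proof (cases r)
    case Nil
    then show ?thesis
      using p f assms(2) sp_real[of "[]" "rng G e \<inter> A" n] by (simp add: sp_simps rel)
  next
    case (Cons g r')
    then show ?thesis
      using p f assms(2) sp_real[of r A n]
      by (auto simp: P_sp_Cons gv subspace_0[OF subspace_parts(1)])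
  qed
  then show "S' e * y \<in> real_part n"
    using p f assms(2) by (auto simp: sp_simps rel subspace_0[OF subspace_parts(1)])
qed

text \<open>The equation persists for larger \<open>F\<close>, which makes it stable under linear combinations.\<close>

lemma pos_part_expand_all:
  assumes "x \<in> pos_part n"
  shows "\<exists>F. finite F \<and> F \<subseteq> edges G \<and>
    (\<forall>F'. finite F' \<and> F \<subseteq> F' \<and> F' \<subseteq> edges G \<longrightarrow> x = (\<Sum>e\<in>F'. S e * (S' e * x)))"
  using assms unfolding pos_part_def
proof (induction rule: span_induct_alt)
  case base
  then show ?case by auto
next
  case (step c x y)
  then obtain p A where p: "x = sp p A" "p \<noteq> []" "set p \<subseteq> edges G" by blast
  then obtain f r where f: "p = f # r" "f \<in> edges G" by (cases p) auto
  obtain F where F: "finite F" "F \<subseteq> edges G"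
      "\<And>F'. \<lbrakk>finite F'; F \<subseteq> F'; F' \<subseteq> edges G\<rbrakk> \<Longrightarrow> y = (\<Sum>e\<in>F'. S e * (S' e * y))"
    using step.IH by metis
  have "c *s x + y = (\<Sum>e\<in>F'. S e * (S' e * (c *s x + y)))"
    if F': "finite F'" "insert f F \<subseteq> F'" "F' \<subseteq> edges G" for F'
  proof -
    have "(\<Sum>e\<in>F'. S e * (S' e * x)) = (\<Sum>e\<in>F'. if e = f then S f * sp r A else 0)"
      using F' f by (intro sum.cong refl) (auto simp: p(1) f(1) sp_simps rel)
    also have "\<dots> = x"
      using F' by (simp add: p(1) f(1) sp_simps)
    finally have x: "x = (\<Sum>e\<in>F'. S e * (S' e * x))" by simp
    have "(\<Sum>e\<in>F'. S e * (S' e * (c *s x + y))) =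
        c *s (\<Sum>e\<in>F'. S e * (S' e * x)) + (\<Sum>e\<in>F'. S e * (S' e * y))"
      by (simp add: distrib_left sum.distrib sm_mult_right scale_sum_right)
    also have "\<dots> = c *s x + y"
      using F(3)[of F'] F' x by simp
    finally show ?thesis by simp
  qed
  then show ?case
    using F f by (intro exI[of _ "insert f F"]) auto
qed

lemma pos_part_expand:
  assumes "x \<in> pos_part n"
  obtains F where "finite F" "F \<subseteq> edges G" "x = (\<Sum>e\<in>F. S e * (S' e * x))"
  using pos_part_expand_all[OF assms] by blast

lemma real_part_split:
  assumes "x \<in> real_part n"
  shows "\<exists>z u. x = z + u \<and> z \<in> span (P ` gen_verts G) \<and> u \<in> pos_part n"
  using assms unfolding real_part_def
proof (induction rule: span_induct_alt)
  case base
  then show ?case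
    using subspace_0[OF subspace_parts(2)] span_zero by (intro exI[of _ 0]) auto
next
  case (step c x y)
  then obtain z u where zu: "y = z + u" "z \<in> span (P ` gen_verts G)" "u \<in> pos_part n" by blast
  obtain p A where p: "x = sp p A" "set p \<subseteq> edges G" "A \<in> gen_verts G" "length p < n"
    using step by blast
  show ?case
  proof (cases "p = []")
    case True
    then have "c *s x \<in> span (P ` gen_verts G)"
      using p span_base[of "P A" "P ` gen_verts G"] by (simp add: sp_simps span_scale)
    then show ?thesis
      using zu by (intro exI[of _ "c *s x + z"] exI[of _ u]) (auto simp: span_add)
  next
    case False
    then have "c *s x \<in> pos_part n"
      using p sp_pos subspace_scale[OF subspace_parts(2)] by blast
    then show ?thesis
      using zu subspace_add[OF subspace_parts(2)]
      by (intro exI[of _ z] exI[of _ "c *s x + u"]) auto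
  qed
qed

text \<open>For \<A> take the sets that occur in \<open>z\<close>. If \<open>B\<close> is contained
  in or disjoint from each of them, every summand acts on \<open>P B\<close> as 0 or as its
  coefficient.\<close>

lemma span_P_pure:
  assumes "z \<in> span (P ` gen_verts G)"
  shows "\<exists>\<A>. finite \<A> \<and> \<A> \<subseteq> gen_verts G \<and>
    (\<forall>B\<in>gen_verts G. (\<forall>A\<in>\<A>. B \<subseteq> A \<or> B \<inter> A = {}) \<longrightarrow> (\<exists>k. z * P B = k *s P B))"
  using assms
proof (induction rule: span_induct_alt)
  case base
  show ?case by (intro exI[of _ "{}"]) (auto intro: exI[of _ 0])
next
  case (step c x y)
  then obtain A where A: "x = P A" "A \<in> gen_verts G" by blast
  obtain \<A> where \<A>: "finite \<A>" "\<A> \<subseteq> gen_verts G"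
    "\<And>B. \<lbrakk>B \<in> gen_verts G; \<forall>A\<in>\<A>. B \<subseteq> A \<or> B \<inter> A = {}\<rbrakk> \<Longrightarrow> \<exists>k. y * P B = k *s P B"
    using step.IH by metis
  have "\<exists>k. (c *s x + y) * P B = k *s P B"
    if B: "B \<in> gen_verts G" "\<forall>A\<in>insert A \<A>. B \<subseteq> A \<or> B \<inter> A = {}" for B
  proof -
    obtain k where "y * P B = k *s P B"
      using \<A>(3)[OF B(1)] B(2) by auto
    moreover have "x * P B = (if B \<subseteq> A then 1 else 0) *s P B"
      using A B by (auto simp: P_P P_empty Int_absorb1 Int_commute)
    ultimately have "(c *s x + y) * P B = (c * (if B \<subseteq> A then 1 else 0) + k) *s P B"
      by (simp add: distrib_right sm_mult_left scale_left_distrib)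
    then show ?thesis by blast
  qed
  then show ?case
    using \<A> A by (intro exI[of _ "insert A \<A>"]) auto
qed

lemma span_P_vertex:
  assumes "z \<in> span (P ` gen_verts G)" "w \<in> verts G"
  obtains k where "z * P {w} = k *s P {w}"
  using span_P_pure[OF assms(1)] gen_verts.vertex[OF assms(2)] by blast


subsection \<open>Absorbing subspaces\<close>

text \<open>A two-sided ideal relative to the subalgebra of the generators: multiplication by other
  elements of the ring type is left out.\<close>

definition absorbing :: "'a set \<Rightarrow> bool" where
  "absorbing I \<longleftrightarrow> subspace I \<and> (\<forall>x\<in>I.
     (\<forall>A\<in>gen_verts G. P A * x \<in> I \<and> x * P A \<in> I) \<and>
     (\<forall>e\<in>edges G. S e * x \<in> I \<and> x * S e \<in> I \<and> S' e * x \<in> I \<and> x * S' e \<in> I))"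

lemma absorbing_subspace: "absorbing I \<Longrightarrow> subspace I"
  by (simp add: absorbing_def)

lemma absorbing_gens:
  assumes "absorbing I" "x \<in> I"
  shows "A \<in> gen_verts G \<Longrightarrow> P A * x \<in> I" "A \<in> gen_verts G \<Longrightarrow> x * P A \<in> I"
    "e \<in> edges G \<Longrightarrow> S e * x \<in> I" "e \<in> edges G \<Longrightarrow> x * S e \<in> I"
    "e \<in> edges G \<Longrightarrow> S' e * x \<in> I" "e \<in> edges G \<Longrightarrow> x * S' e \<in> I"
  using assms by (auto simp: absorbing_def)

lemma absorbing_sp:
  assumes I: "absorbing I" and x: "x \<in> I" and p: "set p \<subseteq> edges G" and A: "A \<in> gen_verts G"
  shows "sp p A * x \<in> I" "x * sp p A \<in> I"
proof -
  show "sp p A * x \<in> I"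
    using p by (induction p) (use x A in \<open>auto simp: sp_simps mult.assoc intro: absorbing_gens[OF I]\<close>)
  show "x * sp p A \<in> I"
    using p x
    by (induction p arbitrary: x)
      (use A in \<open>auto simp: sp_simps mult.assoc[symmetric] intro: absorbing_gens[OF I]\<close>)
qed

lemma absorbing_ps:
  assumes I: "absorbing I" and x: "x \<in> I" and p: "set p \<subseteq> edges G" and A: "A \<in> gen_verts G"
  shows "ps A p * x \<in> I" "x * ps A p \<in> I"
proof -
  show "x * ps A p \<in> I"
    using p
    by (induction p)
      (use x A in \<open>auto simp: ps_simps mult.assoc[symmetric] intro: absorbing_gens[OF I]\<close>)
  show "ps A p * x \<in> I"
    using p x
    by (induction p arbitrary: x)
      (use A in \<open>auto simp: ps_simps mult.assoc intro: absorbing_gens[OF I]\<close>)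
qed

lemma absorbing_real:
  assumes "absorbing I" "x \<in> I" "y \<in> real_part n"
  shows "y * x \<in> I"
  by (rule span_image_right[OF assms(3)[unfolded real_part_def] absorbing_subspace[OF assms(1)]])
    (use assms in \<open>auto intro: absorbing_sp\<close>)

text \<open>Intersecting with \<open>out_edges G v\<close> lets one finite set \<open>F\<close>
  serve all vertices \<open>v\<close> at the same time.\<close>

definition q :: "'v \<Rightarrow> 'e set \<Rightarrow> 'a" where
  "q v F = P {v} - (\<Sum>e\<in>F \<inter> out_edges G v. S e * S' e)"

lemma q_S:
  assumes "finite F" "F \<subseteq> edges G" "v \<in> verts G" "e \<in> edges G"
  shows "q v F * S e = (if src G e = v \<and> e \<notin> F then S e else 0)"
proof -
  have "(\<Sum>f\<in>F \<inter> out_edges G v. S f * S' f) * S e =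
      (\<Sum>f\<in>F \<inter> out_edges G v. if f = e then S e else 0)"
    unfolding sum_distrib_right
    using assms by (intro sum.cong refl) (auto simp: mult.assoc rel)
  also have "\<dots> = (if e \<in> F \<and> src G e = v then S e else 0)"
    using assms by (simp add: out_edges_def)
  finally show ?thesis
    using assms by (auto simp: q_def left_diff_distrib rel)
qed

lemma S'_q:
  assumes "finite F" "F \<subseteq> edges G" "v \<in> verts G" "e \<in> edges G"
  shows "S' e * q v F = (if src G e = v \<and> e \<notin> F then S' e else 0)"
proof -
  have "S' e * (\<Sum>f\<in>F \<inter> out_edges G v. S f * S' f) =
      (\<Sum>f\<in>F \<inter> out_edges G v. if f = e then S' e else 0)"
    unfolding sum_distrib_left
    using assms by (intro sum.cong refl) (auto simp: rel)
  also have "\<dots> = (if e \<in> F \<and> src G e = v then S' e else 0)"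
    using assms by (simp add: out_edges_def)
  finally show ?thesis
    using assms by (auto simp: q_def right_diff_distrib rel)
qed

lemma q_P: "\<lbrakk>F \<subseteq> edges G; v \<in> verts G\<rbrakk> \<Longrightarrow> q v F * P {v} = q v F"
  unfolding q_def left_diff_distrib sum_distrib_right
  by (simp add: rel, intro sum.cong refl) (auto simp: mult.assoc rel out_edges_def)

lemma P_q: "\<lbrakk>F \<subseteq> edges G; v \<in> verts G\<rbrakk> \<Longrightarrow> P {v} * q v F = q v F"
  unfolding q_def right_diff_distrib sum_distrib_left
  by (simp add: rel, intro sum.cong refl) (auto simp: rel out_edges_def)

text \<open>The projections shrink as the edge set grows: \<open>q v F'\<close> annihilates
  \<open>S f\<close> from the left and \<open>S' f\<close> from the right for each \<open>f\<close>
  in \<open>F\<close>, so only \<open>P {v}\<close> is left of \<open>q v F\<close>.\<close>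

lemma q_q:
  assumes "finite F'" "F \<subseteq> F'" "F' \<subseteq> edges G" "v \<in> verts G"
  shows "q v F' * q v F = q v F'" "q v F * q v F' = q v F'"
proof -
  have "q v F' * (\<Sum>f\<in>F \<inter> out_edges G v. S f * S' f) = 0"
    unfolding sum_distrib_left
    using assms by (intro sum.neutral) (auto simp: mult.assoc[symmetric] q_S out_edges_def)
  then show "q v F' * q v F = q v F'"
    using assms by (subst (2) q_def) (simp add: right_diff_distrib q_P)
  have "(\<Sum>f\<in>F \<inter> out_edges G v. S f * S' f) * q v F' = 0"
    unfolding sum_distrib_right
    using assms by (intro sum.neutral) (auto simp: mult.assoc S'_q out_edges_def)
  then show "q v F * q v F' = q v F'"
    using assms by (subst q_def) (simp add: left_diff_distrib P_q)
qed

lemma absorbing_q: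
  assumes I: "absorbing I" and x: "x \<in> I" and F: "F \<subseteq> edges G" and v: "v \<in> verts G"
  shows "x * q v F \<in> I" "q v F * x \<in> I"
proof -
  note sub = absorbing_subspace[OF I]
  show "x * q v F \<in> I"
    unfolding q_def right_diff_distrib sum_distrib_left mult.assoc[symmetric]
    using x F v
    by (intro subspace_diff[OF sub] subspace_sum[OF sub] absorbing_gens[OF I])
      (auto simp: gv out_edges_def)
  show "q v F * x \<in> I"
    unfolding q_def left_diff_distrib sum_distrib_right mult.assoc
    using x F v
    by (intro subspace_diff[OF sub] subspace_sum[OF sub] absorbing_gens[OF I])
      (auto simp: gv out_edges_def)
qed

section \<open>Corners at a vertex and orthogonality of first return paths\<close>

lemma sp_empty: "set p \<subseteq> edges G \<Longrightarrow> sp p {} = 0"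
  by (induction p) (simp_all add: sp_simps P_empty)

text \<open>Inserting \<open>P (rng G e)\<close> after \<open>S e\<close> exposes the first failure:
  the next source, or finally \<open>w\<close>, lies outside the range, and the intersection is
  empty.\<close>

lemma sp_not_path:
  assumes "set p \<subseteq> edges G" "p \<noteq> []" "w \<in> verts G" "\<not> (edge_path G p \<and> w \<in> path_rng G p)"
  shows "sp p {w} = 0"
  using assms
proof (induction p)
  case (Cons e p)
  show ?case
  proof (cases p)
    case Nil
    then have "S e * (P (rng G e) * P {w}) = 0"
      using Cons.prems by (auto simp: P_P gv P_empty edge_path_Cons path_rng_def)
    then show ?thesis
      using Cons.prems Nil by (simp add: sp_simps S_P_rng_assoc)
  next
    case (Cons f r)
    show ?thesis
    proof (cases "edge_path G p \<and> w \<in> path_rng G p")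
      case True
      then have "src G f \<notin> rng G e"
        using Cons.prems Cons by (auto simp: edge_path_Cons path_rng_def)
      then have "S e * (P (rng G e) * (S f * sp r {w})) = 0"
        using Cons.prems Cons by (simp add: rel)
      then show ?thesis
        using Cons.prems Cons by (simp add: sp_simps S_P_rng_assoc)
    qed (use Cons.prems Cons.IH Cons in \<open>simp add: sp_simps\<close>)
  qed
qed simp

text \<open>The left factor selects the terms whose first edge starts at \<open>w\<close>, the right
  one replaces \<open>A\<close> by \<open>A \<inter> {w}\<close>. By \<open>sp_not_path\<close> only
  closed paths survive.\<close>

lemma corner_pos_part:
  assumes "x \<in> pos_part n" "w \<in> verts G"
  shows "P {w} * x * P {w} \<in> span {sp p {w} |p. closed_path_at G w p}" (is "_ \<in> ?C")
proof (rule span_image[OF assms(1)[unfolded pos_part_def], where f = "\<lambda>x. P {w} * x * P {w}"])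
  fix y assume "y \<in> {sp p A |p A. p \<noteq> [] \<and> set p \<subseteq> edges G \<and> A \<in> gen_verts G \<and> length p < n}"
  then obtain p A where p: "y = sp p A" "p \<noteq> []" "set p \<subseteq> edges G" "A \<in> gen_verts G"
    by blast
  then obtain e r where e: "p = e # r" "e \<in> edges G" by (cases p) auto
  have y: "P {w} * y * P {w} = (if src G e = w \<and> w \<in> A then sp p {w} else 0)"
    using p e assms(2) sp_P[OF p(3,4), of "{w}"]
    by (auto simp: P_sp_Cons gv sp_empty)
  show "P {w} * y * P {w} \<in> ?C"
  proof (cases "src G e = w \<and> w \<in> A \<and> edge_path G p \<and> w \<in> path_rng G p")
    case True
    then have "closed_path_at G w p"
      using e by (simp add: closed_path_at_def path_src_def)
    then show ?thesis
      using y True by (auto intro: span_base)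
  next
    case False
    then have "P {w} * y * P {w} = 0"
      using y sp_not_path[OF p(3,2) assms(2)] by auto
    then show ?thesis by (simp add: span_zero)
  qed
qed (simp_all add: algebra_simps sm_mult_left sm_mult_right)

lemma P_rng_sp:
  assumes "edge_path G (e # p)" "w \<in> path_rng G (e # p)" "w \<in> verts G"
  shows "P (rng G e) * sp p {w} = sp p {w}"
  using assms
  by (cases p) (auto simp: sp_simps rel edge_path_Cons path_rng_def Int_absorb1 Int_commute)

text \<open>Equal edges cancel, different ones give 0. If one path runs out first, the next edge of
  the other does not start at \<open>w\<close> and meets \<open>P {w}\<close>, which kills it. This
  handles the case of a proper prefix.\<close>

lemma ps_sp_avoiding:
  assumes "w \<in> verts G"
    and "\<forall>e\<in>set p. src G e \<noteq> w" "p \<noteq> [] \<longrightarrow> edge_path G p \<and> w \<in> path_rng G p"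
    and "\<forall>e\<in>set r. src G e \<noteq> w" "r \<noteq> [] \<longrightarrow> edge_path G r \<and> w \<in> path_rng G r"
  shows "ps {w} p * sp r {w} = (if p = r then P {w} else 0)"
  using assms(2-)
proof (induction p r rule: list_induct2')
  case (4 e p f r)
  have ef: "e \<in> edges G" "f \<in> edges G"
    using 4 by (auto simp: edge_path_Cons)
  have "ps {w} (e # p) * sp (f # r) {w} = (if e = f then ps {w} p * sp r {w} else 0)"
    using ef 4 P_rng_sp[of f r w] assms(1)
    by (simp add: sp_simps ps_simps mult.assoc rel)
  also have "\<dots> = (if e # p = f # r then P {w} else 0)"
    using 4 by (auto simp: edge_path_Cons path_rng_def split: if_splits)
  finally show ?case .
qed (use assms(1) in \<open>auto simp: sp_simps ps_simps rel edge_path_Cons mult.assoc\<close>)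

text \<open>The first edges do start at \<open>w\<close>, so they are cancelled separately. The
  tails then avoid \<open>w\<close> as \<open>ps_sp_avoiding\<close> demands.\<close>

lemma ps_sp_first_return:
  assumes "w \<in> verts G" "first_return G w x" "first_return G w y"
  shows "ps {w} x * sp y {w} = (if x = y then P {w} else 0)"
proof -
  obtain e p f r where x: "x = e # p" and y: "y = f # r"
    using assms(2,3) by (cases x; cases y) (auto simp: first_return_def closed_path_at_def edge_path_def)
  have paths: "edge_path G (e # p)" "w \<in> path_rng G (e # p)" "edge_path G (f # r)"
      "w \<in> path_rng G (f # r)"
    using assms by (auto simp: x y first_return_def closed_path_at_def)
  then have ef: "e \<in> edges G" "f \<in> edges G"
    by (auto simp: edge_path_Cons)
  have "ps {w} x * sp y {w} = (if e = f then ps {w} p * sp r {w} else 0)"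
    using ef P_rng_sp[of f r w] assms(1) paths
    by (simp add: x y sp_simps ps_simps mult.assoc rel)
  moreover have "ps {w} p * sp r {w} = (if p = r then P {w} else 0)"
    using assms paths
    by (intro ps_sp_avoiding) (auto simp: first_return_def edge_path_Cons path_rng_def x y)
  ultimately show ?thesis by (auto simp: x y split: if_splits)
qed

section \<open>Words in first return paths\<close>

primrec word :: "'v \<Rightarrow> 'e list list \<Rightarrow> 'a" where
  "word w [] = P {w}"
| "word w (x # xs) = sp x {w} * word w xs"

text \<open>The first letter stands at the right end. There it meets the first letter of a following
  \<open>word\<close>, and \<open>ps_sp_first_return\<close> cancels letter by letter, as in a free
  monoid.\<close>

primrec ghost_word :: "'v \<Rightarrow> 'e list list \<Rightarrow> 'a" where
  "ghost_word w [] = P {w}"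
| "ghost_word w (x # xs) = ghost_word w xs * ps {w} x"

lemma P_sp_closed: "\<lbrakk>w \<in> verts G; closed_path_at G w p\<rbrakk> \<Longrightarrow> P {w} * sp p {w} = sp p {w}"
  by (cases p) (auto simp: closed_path_at_def edge_path_Cons path_src_def P_sp_Cons gv,
    auto simp: edge_path_def)

lemma ps_closed_P: "\<lbrakk>w \<in> verts G; closed_path_at G w p\<rbrakk> \<Longrightarrow> ps {w} p * P {w} = ps {w} p"
  by (cases p) (auto simp: closed_path_at_def edge_path_Cons path_src_def ps_Cons_P gv,
    auto simp: edge_path_def)

lemma sp_append: "P {w} * sp r {w} = sp r {w} \<Longrightarrow> sp p {w} * sp r {w} = sp (p @ r) {w}"
  by (induction p) (simp_all add: sp_simps mult.assoc)

lemma P_word: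
  "\<lbrakk>w \<in> verts G; \<forall>x\<in>set xs. first_return G w x\<rbrakk> \<Longrightarrow> P {w} * word w xs = word w xs"
  by (cases xs) (auto simp: rel mult.assoc[symmetric] P_sp_closed first_return_def)

lemma ghost_word_P:
  "\<lbrakk>w \<in> verts G; \<forall>x\<in>set xs. first_return G w x\<rbrakk> \<Longrightarrow> ghost_word w xs * P {w} = ghost_word w xs"
  by (cases xs) (auto simp: rel mult.assoc ps_closed_P first_return_def)

lemma word_append:
  "\<lbrakk>w \<in> verts G; \<forall>x\<in>set ys. first_return G w x\<rbrakk> \<Longrightarrow> word w xs * word w ys = word w (xs @ ys)"
  by (induction xs) (auto simp: mult.assoc P_word)

lemma word_concat:
  "\<lbrakk>w \<in> verts G; \<forall>x\<in>set xs. first_return G w x\<rbrakk> \<Longrightarrow> word w xs = sp (concat xs) {w}"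
proof (induction xs)
  case (Cons x xs)
  then show ?case
    using P_word[of w xs] by (simp add: sp_append)
qed (simp add: sp_simps)

text \<open>The bound on the lengths guarantees that the word is used up first, so the remainder is
  a ghost word.\<close>

lemma ghost_word_word:
  assumes "w \<in> verts G"
  shows "\<lbrakk>\<forall>x\<in>set xs. first_return G w x; \<forall>x\<in>set ys. first_return G w x; length ys \<le> length xs\<rbrakk> \<Longrightarrow>
    ghost_word w xs * word w ys =
      (if take (length ys) xs = ys then ghost_word w (drop (length ys) xs) else 0)"
proof (induction ys arbitrary: xs)
  case Nil
  then show ?case using assms by (simp add: ghost_word_P)
next
  case (Cons y ys)
  then obtain x xs' where xs: "xs = x # xs'" by (cases xs) auto
  have "ghost_word w xs * word w (y # ys) = ghost_word w xs' * ((ps {w} x * sp y {w}) * word w ys)"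
    by (simp add: xs mult.assoc)
  also have "\<dots> = (if x = y then ghost_word w xs' * word w ys else 0)"
    using Cons assms by (simp add: xs ps_sp_first_return P_word)
  finally show ?case
    using Cons by (simp add: xs)
qed

lemma absorbing_word:
  assumes "absorbing I" "t \<in> I" "w \<in> verts G" "\<forall>x\<in>set xs. first_return G w x"
  shows "t * word w xs \<in> I" "ghost_word w xs * t \<in> I"
proof -
  have "t * word w xs \<in> I"
    using assms(2,4)
  proof (induction xs arbitrary: t)
    case (Cons x xs)
    then have "t * sp x {w} \<in> I"
      using assms(3) closed_path_edges[of G w x]
      by (intro absorbing_sp[OF assms(1)]) (auto simp: first_return_def gv)
    then show ?case
      using Cons by (simp add: mult.assoc[symmetric])
  qed (use assms in \<open>auto intro: absorbing_gens gv\<close>)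
  moreover have "ghost_word w xs * t \<in> I"
    using assms(2,4)
  proof (induction xs arbitrary: t)
    case (Cons x xs)
    then have "ps {w} x * t \<in> I"
      using assms(3) closed_path_edges[of G w x]
      by (intro absorbing_ps[OF assms(1)]) (auto simp: first_return_def gv)
    then show ?case
      using Cons by (simp add: mult.assoc)
  qed (use assms in \<open>auto intro: absorbing_gens gv\<close>)
  ultimately show "t * word w xs \<in> I" "ghost_word w xs * t \<in> I" by auto
qed

text \<open>For distinct first return paths \<open>a\<close> and \<open>b\<close>, conjugation by \<open>a\<^sup>N b\<close> with large \<open>N\<close> kills
  every closed path: a word that is a prefix of \<open>a\<^sup>N\<close> is \<open>a\<^sup>j\<close>, and then \<open>b\<close> meets \<open>a\<close>.\<close>

lemma conjugation_kills_closed_paths: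
  assumes w: "w \<in> verts G" and a: "first_return G w a" and b: "first_return G w b" and ab: "a \<noteq> b"
    and s: "s \<in> span {sp p {w} |p. closed_path_at G w p}"
  shows "\<exists>N. \<forall>n\<ge>N. ghost_word w (replicate n a @ [b]) * s * word w (replicate n a @ [b]) = 0"
  using s
proof (induction rule: span_induct_alt)
  case base
  then show ?case by simp
next
  case (step c x y)
  then obtain p where p: "x = sp p {w}" "closed_path_at G w p" by blast
  obtain xs where xs: "xs \<noteq> []" "\<forall>x\<in>set xs. first_return G w x" "p = concat xs"
    using closed_path_concat_first_returns[OF p(2)] by blast
  obtain N where N: "\<And>n. n \<ge> N \<Longrightarrow>
      ghost_word w (replicate n a @ [b]) * y * word w (replicate n a @ [b]) = 0"
    using step.IH by blast
  have x: "x = word w xs"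
    using word_concat[OF w xs(2)] by (simp add: p xs)
  have "ghost_word w (replicate n a @ [b]) * x * word w (replicate n a @ [b]) = 0"
    if n: "n \<ge> length xs" for n
  proof (cases "xs = replicate (length xs) a")
    case False
    then have "ghost_word w (replicate n a @ [b]) * x = 0"
      unfolding x using a b xs n by (subst ghost_word_word[OF w]) auto
    then show ?thesis by simp
  next
    case True
    define j where "j = length xs"
    have j: "j \<noteq> 0" "j \<le> n" "xs = replicate j a"
      using xs True n by (auto simp: j_def)
    let ?l = "replicate (n - j) a @ [b]"
    have "ghost_word w (replicate n a @ [b]) * x = ghost_word w ?l"
      unfolding x j(3) using a b j(2) by (subst ghost_word_word[OF w]) auto
    \<comment> \<open>Since \<open>j \<ge> 1\<close>, the first \<open>n - j + 1\<close> letters are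
      all \<open>a\<close>. The ghost word of \<open>?l\<close> has the same length but ends in
      \<open>b\<close>, so the two annihilate each other.\<close>
    moreover have "word w (replicate n a @ [b]) =
        word w (replicate (n - j + 1) a) * word w (replicate (j - 1) a @ [b])"
    proof -
      have "replicate n a @ [b] = replicate (n - j + 1) a @ (replicate (j - 1) a @ [b])"
        using j(1,2) replicate_add[of "n - j + 1" "j - 1" a] by simp
      then show ?thesis
        using a b by (simp only: word_append[OF w, symmetric]) (subst word_append[OF w], auto)
    qed
    moreover have "ghost_word w ?l * word w (replicate (n - j + 1) a) = 0"
    proof -
      have "?l \<noteq> replicate (n - j + 1) a"
        using ab by (simp only: Suc_eq_plus1[symmetric] replicate_Suc replicate_append_same[symmetric]) simp
      then show ?thesis
        using a b by (subst ghost_word_word[OF w]) auto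
    qed
    ultimately show ?thesis
      by (simp add: mult.assoc[symmetric])
  qed
  then have "ghost_word w (replicate n a @ [b]) * (c *s x + y) * word w (replicate n a @ [b]) = 0"
    if "n \<ge> max N (length xs)" for n
    using N[of n] that by (simp add: distrib_left distrib_right sm_mult_left sm_mult_right)
  then show ?case by blast
qed

text \<open>Every closed path at \<open>w\<close> is a concatenation of first return paths, hence a
  power of \<open>c\<close>. Requiring zero coefficients beyond \<open>M\<close> allows two such
  sums to be padded to a common range and added.\<close>

lemma span_cycle_powers:
  assumes w: "w \<in> verts G" and unique: "\<And>d. first_return G w d \<Longrightarrow> d = c"
    and s: "s \<in> span {sp p {w} |p. closed_path_at G w p}"
  shows "\<exists>M \<kappa>. (\<forall>j>M. \<kappa> j = 0) \<and> s = (\<Sum>j=1..M. \<kappa> j *s sp (concat (replicate j c)) {w})"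
  using s
proof (induction rule: span_induct_alt)
  case base
  then show ?case by (intro exI[of _ "0::nat"] exI[of _ "\<lambda>_. 0"]) simp
next
  case (step k x y)
  then obtain p where p: "x = sp p {w}" "closed_path_at G w p" by blast
  obtain xs where xs: "xs \<noteq> []" "\<forall>x\<in>set xs. first_return G w x" "p = concat xs"
    using closed_path_concat_first_returns[OF p(2)] by blast
  obtain M \<kappa> where M: "\<And>j. j > M \<Longrightarrow> \<kappa> j = 0"
      "y = (\<Sum>j=1..M. \<kappa> j *s sp (concat (replicate j c)) {w})"
    using step.IH by blast
  define n where "n = length xs"
  have n: "n \<ge> 1" "xs = replicate n c"
    using xs unique replicate_length_same[of xs c] by (auto simp: n_def Suc_le_eq)
  define t where "t j = sp (concat (replicate j c)) {w}" for j
  have "y = (\<Sum>j=1..max M n. \<kappa> j *s t j)"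
    unfolding M(2) t_def by (rule sum.mono_neutral_left) (auto simp: M(1))
  moreover have "k *s x = (\<Sum>j=1..max M n. if j = n then k *s t n else 0)"
    using n by (simp add: p xs(3) t_def)
  ultimately have "k *s x + y =
      (\<Sum>j=1..max M n. \<kappa> j *s t j + (if j = n then k *s t n else 0))"
    by (simp only: sum.distrib add.commute)
  also have "\<dots> = (\<Sum>j=1..max M n. (\<kappa>(n := \<kappa> n + k)) j *s t j)"
    by (intro sum.cong refl) (auto simp: scale_left_distrib)
  finally have "k *s x + y = \<dots>" .
  then show ?case
    unfolding t_def by (intro exI[of _ "max M n"] exI[of _ "\<kappa>(n := \<kappa> n + k)"]) (auto simp: M(1))
qed


subsection \<open>Elements with ghost edges\<close>

lemma ps_P:
  assumes "set r \<subseteq> edges G" "B \<in> gen_verts G" "C \<in> gen_verts G"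
  shows "\<exists>D\<in>gen_verts G. ps B r * P C = ps D r \<or> ps B r * P C = 0"
proof (cases r)
  case Nil
  then show ?thesis
    using assms by (intro bexI[of _ "B \<inter> C"]) (auto simp: ps_simps rel)
next
  case (Cons e r')
  then show ?thesis
    using assms by (intro bexI[of _ B]) (auto simp: ps_Cons_P)
qed

lemma sp_ps_ghost:
  "\<lbrakk>set p \<subseteq> edges G; set r \<subseteq> edges G; A \<in> gen_verts G; B \<in> gen_verts G; length r \<le> n\<rbrakk> \<Longrightarrow>
    sp p A * ps B r \<in> ghost_part n"
  unfolding ghost_part_def by (rule span_base) auto

lemma sp_ghost:
  assumes "set p \<subseteq> edges G" "A \<in> gen_verts G"
  shows "sp p A \<in> ghost_part n"
  using sp_ps_ghost[of p "[]" A A n] assms by (simp add: ps_simps sp_P)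

lemma ghost_part_P:
  assumes "x \<in> ghost_part n" "C \<in> gen_verts G"
  shows "x * P C \<in> ghost_part n"
proof (rule span_image_right[OF assms(1)[unfolded ghost_part_def] subspace_parts(3)])
  fix y assume "y \<in> {sp p A * ps B r |p A B r. set p \<subseteq> edges G \<and> set r \<subseteq> edges G \<and>
     A \<in> gen_verts G \<and> B \<in> gen_verts G \<and> length r \<le> n}"
  then obtain p A B r where y: "y = sp p A * ps B r" "set p \<subseteq> edges G" "set r \<subseteq> edges G"
     "A \<in> gen_verts G" "B \<in> gen_verts G" "length r \<le> n"
    by blast
  obtain D where "D \<in> gen_verts G" "ps B r * P C = ps D r \<or> ps B r * P C = 0"
    using ps_P[OF y(3,5) assms(2)] by blast
  then show "y * P C \<in> ghost_part n"
    using y by (auto simp: mult.assoc subspace_0[OF subspace_parts(3)] intro: sp_ps_ghost)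
qed

text \<open>\<open>S e\<close> meets the ghost edge at the right end, the head of \<open>r\<close>,
  and cancels it or kills the term. A term without ghost edges gains a real edge or vanishes, so it
  stays within the bound too.\<close>

lemma ghost_part_S:
  assumes "x \<in> ghost_part (Suc n)" "e \<in> edges G"
  shows "x * S e \<in> ghost_part n"
proof (rule span_image_right[OF assms(1)[unfolded ghost_part_def] subspace_parts(3)])
  note zero = subspace_0[OF subspace_parts(3), of n]
  fix y assume "y \<in> {sp p A * ps B r |p A B r. set p \<subseteq> edges G \<and> set r \<subseteq> edges G \<and>
     A \<in> gen_verts G \<and> B \<in> gen_verts G \<and> length r \<le> Suc n}"
  then obtain p A B r where y: "y = sp p A * ps B r" "set p \<subseteq> edges G" "set r \<subseteq> edges G"
     "A \<in> gen_verts G" "B \<in> gen_verts G" "length r \<le> Suc n"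
    by blast
  show "y * S e \<in> ghost_part n"
  proof (cases r)
    case Nil
    then have "y * S e = sp p (A \<inter> B) * S e"
      using y by (simp add: ps_simps sp_P)
    then show ?thesis
      using y assms(2) zero by (auto simp: sp_S gv intro!: sp_ghost)
  next
    case (Cons f r')
    then have "y * S e = (if f = e then (sp p A * ps B r') * P (rng G f) else 0)"
      using y assms(2) by (simp add: ps_simps mult.assoc rel)
    then show ?thesis
      using y assms(2) zero Cons by (auto intro!: ghost_part_P sp_ps_ghost gv)
  qed
qed

lemma ghost_part_mono: "m \<le> n \<Longrightarrow> ghost_part m \<subseteq> ghost_part n"
  unfolding ghost_part_def by (rule span_mono) fastforce

lemma ghost_part_S':
  assumes "x \<in> ghost_part n" "e \<in> edges G"
  shows "x * S' e \<in> ghost_part (Suc n)"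
proof (rule span_image_right[OF assms(1)[unfolded ghost_part_def] subspace_parts(3)])
  fix y assume "y \<in> {sp p A * ps B r |p A B r. set p \<subseteq> edges G \<and> set r \<subseteq> edges G \<and>
     A \<in> gen_verts G \<and> B \<in> gen_verts G \<and> length r \<le> n}"
  then obtain p A B r where y: "y = sp p A * ps B r" "set p \<subseteq> edges G" "set r \<subseteq> edges G"
     "A \<in> gen_verts G" "B \<in> gen_verts G" "length r \<le> n"
    by blast
  then show "y * S' e \<in> ghost_part (Suc n)"
    using sp_ps_ghost[of p "e # r" A B "Suc n"] assms(2) by (simp add: ps_simps mult.assoc)
qed

lemma ghost_part_0_real:
  assumes "x \<in> ghost_part 0"
  shows "\<exists>n. x \<in> real_part n"
  using assms unfolding ghost_part_def
proof (induction rule: span_induct_alt)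
  case base
  then show ?case using subspace_0[OF subspace_parts(1)] by blast
next
  case (step c x y)
  then obtain p A B where p: "x = sp p A * P B" "set p \<subseteq> edges G" "A \<in> gen_verts G"
      "B \<in> gen_verts G"
    by (auto simp: ps_simps)
  obtain n where "y \<in> real_part n" using step.IH by blast
  then have "y \<in> real_part (max n (Suc (length p)))" "x \<in> real_part (max n (Suc (length p)))"
    using p real_part_mono[of n "max n (Suc (length p))"] by (auto simp: sp_P intro!: sp_real gv)
  then show ?case
    by (meson subspace_add subspace_scale subspace_parts(1))
qed

text \<open>Local units replace the missing unit. Allowing all \<open>D\<close> above
  \<open>C\<close> makes the claim stable under sums, by taking the union of two such sets.\<close>

lemma right_unit:
  assumes "x \<in> ghost_part n"
  shows "\<exists>C\<in>gen_verts G. \<forall>D\<in>gen_verts G. C \<subseteq> D \<longrightarrow> x * P D = x"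
  using assms unfolding ghost_part_def
proof (induction rule: span_induct_alt)
  case base
  then show ?case by (auto intro: gv)
next
  case (step c x y)
  then obtain p A B r where x: "x = sp p A * ps B r" "set r \<subseteq> edges G" "B \<in> gen_verts G"
    by blast
  have "\<exists>C\<in>gen_verts G. \<forall>D\<in>gen_verts G. C \<subseteq> D \<longrightarrow> ps B r * P D = ps B r"
  proof (cases r)
    case Nil
    then show ?thesis
      using x by (intro bexI[of _ B]) (auto simp: ps_simps rel Int_absorb2)
  next
    case (Cons e r')
    then show ?thesis
      using x by (intro bexI[of _ "{src G e}"]) (auto simp: ps_Cons_P gv)
  qed
  then obtain C where C: "C \<in> gen_verts G" "\<forall>D\<in>gen_verts G. C \<subseteq> D \<longrightarrow> x * P D = x"
    unfolding x mult.assoc by metis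
  obtain C' where C': "C' \<in> gen_verts G" "\<forall>D\<in>gen_verts G. C' \<subseteq> D \<longrightarrow> y * P D = y"
    using step.IH by blast
  show ?case
    using C C' by (intro bexI[of _ "C \<union> C'"]) (auto simp: distrib_right sm_mult_left gv)
qed

lemma left_unit:
  assumes "x \<in> ghost_part n"
  shows "\<exists>C\<in>gen_verts G. \<forall>D\<in>gen_verts G. C \<subseteq> D \<longrightarrow> P D * x = x"
  using assms unfolding ghost_part_def
proof (induction rule: span_induct_alt)
  case base
  then show ?case by (auto intro: gv)
next
  case (step c x y)
  then obtain p A B r where x: "x = sp p A * ps B r" "set p \<subseteq> edges G" "A \<in> gen_verts G"
    by blast
  have "\<exists>C\<in>gen_verts G. \<forall>D\<in>gen_verts G. C \<subseteq> D \<longrightarrow> P D * sp p A = sp p A"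
  proof (cases p)
    case Nil
    then show ?thesis
      using x by (intro bexI[of _ A]) (auto simp: sp_simps rel Int_absorb1)
  next
    case (Cons e r')
    then show ?thesis
      using x by (intro bexI[of _ "{src G e}"]) (auto simp: P_sp_Cons gv)
  qed
  then obtain C where C: "C \<in> gen_verts G" "\<forall>D\<in>gen_verts G. C \<subseteq> D \<longrightarrow> P D * x = x"
    unfolding x mult.assoc[symmetric] by metis
  obtain C' where C': "C' \<in> gen_verts G" "\<forall>D\<in>gen_verts G. C' \<subseteq> D \<longrightarrow> P D * y = y"
    using step.IH by blast
  show ?case
    using C C' by (intro bexI[of _ "C \<union> C'"]) (auto simp: distrib_left sm_mult_right gv)
qed

lemma real_ghost: "x \<in> real_part n \<Longrightarrow> x \<in> ghost_part m"
  unfolding real_part_def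
  by (erule rev_subsetD, rule span_minimal[OF _ subspace_parts(3)]) (auto intro: sp_ghost)

text \<open>Multiplying by \<open>q v F\<close> or by \<open>P B\<close> with \<open>B\<close> away from the sources of \<open>F\<close> removes the terms
  with ghost edges.\<close>

lemma ghost_part_real_agree:
  assumes "x \<in> ghost_part n"
  shows "\<exists>m. \<exists>y\<in>real_part m. \<exists>F. finite F \<and> F \<subseteq> edges G \<and>
    (\<forall>F'. finite F' \<and> F \<subseteq> F' \<and> F' \<subseteq> edges G \<longrightarrow>
      (\<forall>v\<in>verts G. x * q v F' = y * q v F') \<and>
      (\<forall>B\<in>gen_verts G. (\<forall>e\<in>F'. src G e \<notin> B) \<longrightarrow> x * P B = y * P B))"
  using assms unfolding ghost_part_def
proof (induction rule: span_induct_alt)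
  case base
  then show ?case
    using subspace_0[OF subspace_parts(1), of 0]
    by (intro exI[of _ 0] bexI[of _ 0] exI[of _ "{}"]) auto
next
  case (step c x y)
  obtain p A B r where x: "x = sp p A * ps B r" "set p \<subseteq> edges G" "set r \<subseteq> edges G"
      "A \<in> gen_verts G" "B \<in> gen_verts G"
    using step.hyps(1) by blast
  obtain m z F where F: "z \<in> real_part m" "finite F" "F \<subseteq> edges G"
      "\<And>F' v. \<lbrakk>finite F'; F \<subseteq> F'; F' \<subseteq> edges G; v \<in> verts G\<rbrakk> \<Longrightarrow> y * q v F' = z * q v F'"
      "\<And>F' B. \<lbrakk>finite F'; F \<subseteq> F'; F' \<subseteq> edges G; B \<in> gen_verts G; \<forall>e\<in>F'. src G e \<notin> B\<rbrakk> \<Longrightarrow>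
        y * P B = z * P B"
    using step.IH by metis
  show ?case
  proof (cases r)
    case Nil
    let ?m = "max m (Suc (length p))"
    have "x \<in> real_part ?m" "z \<in> real_part ?m"
      using x Nil F(1) real_part_mono[of m ?m]
      by (auto simp: ps_simps sp_P intro!: sp_real gv)
    then have "c *s x + z \<in> real_part ?m"
      by (meson subspace_add subspace_scale subspace_parts(1))
    then show ?thesis
      using F by (intro exI[of _ ?m] bexI[of _ "c *s x + z"] exI[of _ F]) (auto simp: distrib_right)
  next
    case (Cons e r')
    then have e: "e \<in> edges G" "x = sp p A * ps B r' * S' e"
      using x by (simp_all add: ps_simps mult.assoc)
    have "x * q v F' = 0" if "finite F'" "insert e F \<subseteq> F'" "F' \<subseteq> edges G" "v \<in> verts G" for v F'
      using that e by (simp add: mult.assoc S'_q)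
    moreover have "x * P B = 0" if "insert e F \<subseteq> F'" "B \<in> gen_verts G" "\<forall>e\<in>F'. src G e \<notin> B" for B F'
      using that e by (auto simp: mult.assoc rel)
    ultimately show ?thesis
      using F e by (intro exI[of _ m] bexI[of _ z] exI[of _ "insert e F"])
        (auto simp: distrib_right sm_mult_left)
  qed
qed

end


section \<open>Comparing two ideals\<close>

text \<open>The last three assumptions say which elements \<open>J\<close> inherits from
  \<open>I\<close>: the sets \<open>P A\<close>, the projections \<open>q v F\<close>, and the
  polynomials with constant term \<open>P {w}\<close> in the only cycle at \<open>w\<close>. Each of
  them will turn out to be special.\<close>

locale lpa_ideals = lpa_family sm G P S S'
  for sm :: "'k::field \<Rightarrow> 'a::ring \<Rightarrow> 'a" (infixr "*s" 75)
    and G :: "('v, 'e) ultragraph" and P S S' +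
  fixes I J :: "'a set"
  assumes I: "absorbing I" and J: "absorbing J"
    and P_in_J: "\<lbrakk>A \<in> gen_verts G; A \<noteq> {}; P A \<in> I\<rbrakk> \<Longrightarrow> P A \<in> J"
    and q_in_J: "\<lbrakk>v \<in> verts G; finite F; F \<subseteq> edges G; q v F \<in> I\<rbrakk> \<Longrightarrow> q v F \<in> J"
    and cycle_in_J: "\<lbrakk>w \<in> verts G; cycle_at G w c; \<And>d. cycle_at G w d \<Longrightarrow> d = c;
      P {w} + (\<Sum>j=1..M. \<kappa> j *s sp (concat (replicate j c)) {w}) \<in> I\<rbrakk> \<Longrightarrow>
      P {w} + (\<Sum>j=1..M. \<kappa> j *s sp (concat (replicate j c)) {w}) \<in> J"
begin

lemmas sub_I = absorbing_subspace[OF I] and sub_J = absorbing_subspace[OF J]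
lemmas gens_I = absorbing_gens[OF I] and gens_J = absorbing_gens[OF J]

section \<open>Corner elements and elements without ghost edges\<close>

lemma scaled_in:
  assumes "subspace X" "k \<noteq> 0" "k *s x \<in> X"
  shows "x \<in> X"
  using subspace_scale[OF assms(1,3), of "1 / k"] assms(2) by simp

text \<open>Count the first return paths at \<open>w\<close>. With none \<open>s\<close> vanishes,
  and with two or more a conjugation removes \<open>s\<close>; both put \<open>P {w}\<close> into
  \<open>I\<close>. A single one is a cycle, and dividing by \<open>k\<close> leads to
  \<open>cycle_in_J\<close>.\<close>

lemma corner_in_J:
  assumes w: "w \<in> verts G" and k: "k \<noteq> 0" and s: "s \<in> span {sp p {w} |p. closed_path_at G w p}"
    and t: "k *s P {w} + s \<in> I"
  shows "k *s P {w} + s \<in> J"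
proof -
  have if_P: "k *s P {w} + s \<in> J" if "P {w} \<in> I"
  proof -
    have P: "P {w} \<in> J"
      using that w by (intro P_in_J) (auto intro: gv)
    \<comment> \<open>\<open>sp p {w}\<close> equals \<open>sp p {w} * P {w}\<close>, so
      \<open>P {w}\<close> pulls all of \<open>s\<close> into \<open>J\<close>.\<close>
    have "sp p {w} \<in> J" if "closed_path_at G w p" for p
    proof -
      have "set p \<subseteq> edges G"
        by (rule closed_path_edges[OF that])
      then show ?thesis
        using absorbing_sp(1)[OF J P, of p "{w}"] w by (simp add: sp_P gv)
    qed
    then have "span {sp p {w} |p. closed_path_at G w p} \<subseteq> J"
      by (intro span_minimal[OF _ sub_J]) auto
    then show ?thesis
      using P s sub_J by (auto intro: subspace_add subspace_scale)
  qed
  consider a b where "first_return G w a" "first_return G w b" "a \<noteq> b"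
    | "\<And>a. \<not> first_return G w a"
    | c where "first_return G w c" "\<And>d. first_return G w d \<Longrightarrow> d = c"
    by blast
  then show ?thesis
  proof cases
    case 1
    obtain N where N: "ghost_word w (replicate N a @ [b]) * s * word w (replicate N a @ [b]) = 0"
      using conjugation_kills_closed_paths[OF w 1 s] by blast
    let ?u = "replicate N a @ [b]"
    have u: "\<forall>x\<in>set ?u. first_return G w x"
      using 1 by auto
    \<comment> \<open>The choice of \<open>N\<close> removes \<open>s\<close>, while the two words
      cancel around \<open>P {w}\<close>.\<close>
    have "ghost_word w ?u * (k *s P {w} + s) * word w ?u = k *s P {w}"
      using N w u ghost_word_P[OF w u] ghost_word_word[OF w u u]
      by (simp add: distrib_left distrib_right sm_mult_left sm_mult_right)
    moreover have "ghost_word w ?u * (k *s P {w} + s) * word w ?u \<in> I"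
      by (intro absorbing_word[OF I] t w u)
    ultimately have "P {w} \<in> I"
      using scaled_in[OF sub_I k] by simp
    then show ?thesis by (rule if_P)
  next
    case 2
    have "\<not> closed_path_at G w p" for p
      using closed_path_concat_first_returns[of G w p] 2 by (metis last_in_set)
    then have "s = 0" using s by simp
    then have "P {w} \<in> I"
      using t scaled_in[OF sub_I k] by simp
    then show ?thesis by (rule if_P)
  next
    case 3
    have cyc: "cycle_at G w c"
      by (rule unique_first_return_cycle[OF 3])
    have unique: "d = c" if "cycle_at G w d" for d
      using cycle_first_return[OF that] by (rule 3(2))
    have "(1 / k) *s s \<in> span {sp p {w} |p. closed_path_at G w p}"
      using s by (rule span_scale)
    then obtain M \<kappa> where M: "(1 / k) *s s = (\<Sum>j=1..M. \<kappa> j *s sp (concat (replicate j c)) {w})"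
      using span_cycle_powers[OF w 3(2)] by blast
    have eq: "k *s P {w} + s = k *s (P {w} + (1 / k) *s s)"
      using k by (simp add: scale_right_distrib)
    have "P {w} + (1 / k) *s s \<in> I"
      using t scaled_in[OF sub_I k] unfolding eq by blast
    then have "P {w} + (1 / k) *s s \<in> J"
      unfolding M by (intro cycle_in_J[OF w cyc unique])
    then show ?thesis
      unfolding eq by (rule subspace_scale[OF sub_J])
  qed
qed

text \<open>\<open>x\<close> is the sum of the elements \<open>S e * (S' e * x)\<close> over
  finitely many \<open>e\<close>. Each \<open>S' e * x\<close> lies in \<open>I\<close> and has
  shorter paths, so the assumption on \<open>real_part n\<close> applies to it.\<close>

lemma pos_part_step:
  assumes "x \<in> pos_part (Suc n)" "x \<in> I" "\<And>y. y \<in> I \<Longrightarrow> y \<in> real_part n \<Longrightarrow> y \<in> J"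
  shows "x \<in> J"
proof -
  obtain F where F: "finite F" "F \<subseteq> edges G" "x = (\<Sum>e\<in>F. S e * (S' e * x))"
    using pos_part_expand[OF assms(1)] .
  have "S' e * x \<in> J" if "e \<in> F" for e
    using that F assms S'_pos_part by (blast intro: gens_I)
  then have "(\<Sum>e\<in>F. S e * (S' e * x)) \<in> J"
    using F(2) by (intro subspace_sum[OF sub_J] gens_J(3)) auto
  then show ?thesis
    by (subst F(3))
qed

text \<open>Induction on the length bound. A right unit \<open>C\<close> is cut into pieces
  \<open>B\<close> on which the part of length zero is a scalar \<open>k\<close>. For
  \<open>k = 0\<close> first edges are stripped. Otherwise \<open>B\<close> is cut once more, into
  finitely many vertices and a rest that isolates \<open>k\<close>.\<close>

lemma real_in_J:
  assumes "x \<in> I" "x \<in> real_part n"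
  shows "x \<in> J"
  using assms
proof (induction n arbitrary: x)
  case 0
  then show ?case by (simp add: real_part_0 subspace_0[OF sub_J])
next
  case (Suc n)
  obtain z u where zu: "x = z + u" "z \<in> span (P ` gen_verts G)" "u \<in> pos_part (Suc n)"
    using real_part_split[OF Suc.prems(2)] by blast
  obtain \<A> where \<A>: "finite \<A>" "\<A> \<subseteq> gen_verts G"
    "\<And>B. \<lbrakk>B \<in> gen_verts G; \<forall>A\<in>\<A>. B \<subseteq> A \<or> B \<inter> A = {}\<rbrakk> \<Longrightarrow> \<exists>k. z * P B = k *s P B"
    using span_P_pure[OF zu(2)] by metis
  obtain C where C: "C \<in> gen_verts G" "x * P C = x"
    using right_unit[OF real_ghost[OF Suc.prems(2)]] by blast
  have "x * P C \<in> J"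
  proof (rule gen_verts_pure_induct[OF \<A>(1,2) C(1)])
    fix A B assume "A \<in> gen_verts G" "B \<in> gen_verts G" "A \<inter> B = {}" "x * P A \<in> J" "x * P B \<in> J"
    then show "x * P (A \<union> B) \<in> J"
      by (simp add: P_disjoint_Un distrib_left subspace_add[OF sub_J])
  next
    fix B assume B: "B \<in> gen_verts G" "\<forall>A\<in>\<A>. B \<subseteq> A \<or> B \<inter> A = {}"
    obtain k where k: "z * P B = k *s P B"
      using \<A>(3)[OF B] by blast
    define u' where "u' = u * P B"
    have u': "u' \<in> pos_part (Suc n)"
      unfolding u'_def using zu(3) B(1) by (rule pos_part_P)
    have xB: "x * P B = k *s P B + u'"
      by (simp add: zu(1) distrib_right k u'_def)
    have xB_I: "x * P B \<in> I"
      using Suc.prems(1) B(1) by (rule gens_I)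
    show "x * P B \<in> J"
    proof (cases "k = 0")
      case True
      then show ?thesis
        using pos_part_step[OF u' _ Suc.IH] xB xB_I by simp
    next
      case False
      obtain F where F: "finite F" "F \<subseteq> edges G" "u' = (\<Sum>e\<in>F. S e * (S' e * u'))"
        using pos_part_expand[OF u'] .
      \<comment> \<open>The vertices of \<open>B\<close> at which terms of \<open>u'\<close> can
        begin. Left multiplication by \<open>P (B - W)\<close> therefore kills \<open>u'\<close> and
        leaves \<open>k *s P (B - W)\<close>.\<close>
      define W where "W = src G ` F \<inter> B"
      have B': "B - W \<in> gen_verts G" "P B = P (B - W) + (\<Sum>w\<in>W. P {w})"
        using P_remove_finite[of W B] F(1) B(1) by (auto simp: W_def)
      have "P (B - W) * S e = 0" if "e \<in> F" for e
        using that F(2) P_S[OF B'(1), of e] by (auto simp: W_def)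
      then have "P (B - W) * u' = 0"
        by (subst F(3)) (simp add: sum_distrib_left mult.assoc[symmetric])
      then have "P (B - W) * (x * P B) = k *s P (B - W)"
        using B'(1) B(1) by (simp add: xB distrib_left sm_mult_right rel Int_absorb2)
      then have "k *s P (B - W) \<in> I"
        using gens_I(1)[OF xB_I B'(1)] by simp
      then have "P (B - W) \<in> I"
        by (rule scaled_in[OF sub_I False])
      then have "P (B - W) \<in> J"
        using P_in_J[OF B'(1)] P_empty subspace_0[OF sub_J] by (cases "B - W = {}") metis+
      then have first: "x * P (B - W) \<in> J"
        using absorbing_real[OF J _ Suc.prems(2)] by blast
      have "x * P {w} \<in> J" if "w \<in> W" for w
      proof -
        have w: "w \<in> B" "{w} \<in> gen_verts G" "w \<in> verts G"
          using that B(1) vertex_gen_verts gen_verts_subset[OF ultragraph B(1)] by (auto simp: W_def)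
        have "x * P {w} = x * P B * P {w}"
          using w B(1) by (simp add: mult.assoc rel)
        also have "\<dots> = k *s P {w} + u' * P {w}"
          using w B(1) by (simp add: xB distrib_right sm_mult_left rel)
        finally have xw: "x * P {w} = k *s P {w} + u' * P {w}" .
        have xw_I: "x * P {w} \<in> I"
          using Suc.prems(1) w(2) by (rule gens_I)
        have corner: "P {w} * (x * P {w}) = k *s P {w} + P {w} * u' * P {w}"
          using w by (simp add: xw distrib_left sm_mult_right rel mult.assoc)
        have "k *s P {w} + P {w} * u' * P {w} \<in> I"
          unfolding corner[symmetric] using xw_I w(2) by (rule gens_I)
        then have 1: "P {w} * (x * P {w}) \<in> J"
          unfolding corner using corner_in_J[OF w(3) False corner_pos_part[OF u' w(3)]] by blast
        \<comment> \<open>Outside the corner at \<open>w\<close> the scalar term cancels, so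
          \<open>pos_part_step\<close> applies; the corner itself was settled by
          \<open>corner_in_J\<close>.\<close>
        have diff: "x * P {w} - P {w} * (x * P {w}) = u' * P {w} - P {w} * (u' * P {w})"
          using w by (simp add: xw distrib_left sm_mult_right rel)
        have "x * P {w} - P {w} * (x * P {w}) \<in> I"
          using xw_I gens_I(1)[OF xw_I w(2)] by (rule subspace_diff[OF sub_I])
        moreover have "u' * P {w} - P {w} * (u' * P {w}) \<in> pos_part (Suc n)"
          using u' w(2) by (intro subspace_diff[OF subspace_parts(2)] P_pos_part pos_part_P)
        ultimately have "x * P {w} - P {w} * (x * P {w}) \<in> J"
          unfolding diff by (intro pos_part_step[OF _ _ Suc.IH])
        then show ?thesis
          using subspace_add[OF sub_J _ 1] by fastforce
      qed
      then show ?thesis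
        using first by (simp add: B'(2) distrib_left sum_distrib_left subspace_add[OF sub_J]
          subspace_sum[OF sub_J])
    qed
  qed
  then show ?case by (simp add: C)
qed

text \<open>Here only the product with \<open>q v F\<close> is known to lie in \<open>I\<close>, so
  \<open>real_in_J\<close> does not apply to \<open>x\<close>. The induction again separates the
  scalar \<open>k\<close> at \<open>v\<close> from the terms of positive length.\<close>

lemma real_q_in_J:
  assumes "x \<in> real_part n" "v \<in> verts G" "finite F" "F \<subseteq> edges G" "x * q v F \<in> I"
  shows "x * q v F \<in> J"
  using assms(1,5)
proof (induction n arbitrary: x)
  case 0
  then show ?case by (simp add: real_part_0 subspace_0[OF sub_J])
next
  case (Suc n)
  note v = assms(2) and F = assms(3,4)
  obtain z u where zu: "x = z + u" "z \<in> span (P ` gen_verts G)" "u \<in> pos_part (Suc n)"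
    using real_part_split[OF Suc.prems(1)] by blast
  obtain k where k: "z * P {v} = k *s P {v}"
    using span_P_vertex[OF zu(2) v] by blast
  obtain F1 where F1: "finite F1" "F1 \<subseteq> edges G" "u = (\<Sum>e\<in>F1. S e * (S' e * u))"
    using pos_part_expand[OF zu(3)] .
  have "z * q v F = z * P {v} * q v F"
    using v F by (simp add: mult.assoc P_q)
  then have xq: "x * q v F = k *s q v F + u * q v F"
    using v F by (simp add: zu(1) distrib_right k sm_mult_left P_q)
  show ?case
  proof (cases "k = 0")
    case True
    then have uq: "u * q v F \<in> I"
      using Suc.prems(2) xq by simp
    have "S' e * u * q v F \<in> J" if "e \<in> F1" for e
      using that F1 S'_pos_part[OF zu(3)] gens_I(5)[OF uq]
      by (intro Suc.IH) (auto simp: mult.assoc)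
    then have "(\<Sum>e\<in>F1. S e * (S' e * u * q v F)) \<in> J"
      using F1 by (intro subspace_sum[OF sub_J] gens_J) auto
    also have "(\<Sum>e\<in>F1. S e * (S' e * u * q v F)) = u * q v F"
      by (subst (2) F1(3)) (simp add: sum_distrib_right mult.assoc)
    finally show ?thesis
      using True xq by simp
  next
    case False
    \<comment> \<open>Adding the first edges of \<open>u\<close> makes \<open>q v F'\<close> kill
      \<open>u\<close> from the left, so that multiplying \<open>x * q v F\<close> by it isolates
      \<open>k *s q v F'\<close>.\<close>
    define F' where "F' = F \<union> F1"
    have F': "finite F'" "F' \<subseteq> edges G" "F \<subseteq> F'"
      using F F1 by (auto simp: F'_def)
    have "q v F' * S e = 0" if "e \<in> F1" for e
      using that F1 q_S[OF F'(1,2) v, of e] by (auto simp: F'_def)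
    then have "q v F' * u = 0"
      by (subst F1(3)) (simp add: sum_distrib_left mult.assoc[symmetric])
    then have "q v F' * (x * q v F) = k *s q v F'"
      using F' v by (simp add: xq distrib_left sm_mult_right q_q mult.assoc[symmetric])
    then have "q v F' \<in> I"
      using absorbing_q(2)[OF I Suc.prems(2) F'(2) v] scaled_in[OF sub_I False] by simp
    then have "x * q v F' \<in> J"
      using absorbing_real[OF J _ Suc.prems(1)] q_in_J[OF v F'(1,2)] by blast
    \<comment> \<open>The terms by which \<open>q v F\<close> exceeds \<open>q v F'\<close>. As
      \<open>e\<close> is not in \<open>F\<close>, \<open>q v F\<close> fixes \<open>S e\<close>;
      hence \<open>x * S e\<close> lies in \<open>I\<close>, and it has no ghost edges.\<close>
    moreover have "x * S e * S' e \<in> J" if e: "e \<in> F' \<inter> out_edges G v - F \<inter> out_edges G v" for e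
    proof -
      have e': "e \<in> edges G" "src G e = v" "e \<notin> F"
        using e by (auto simp: out_edges_def)
      have xe: "x * S e = x * q v F * S e"
        using e' F v by (simp add: mult.assoc q_S)
      then have "x * S e \<in> I"
        using gens_I(4)[OF Suc.prems(2) e'(1)] by simp
      moreover obtain m where "x * S e \<in> real_part m"
        using ghost_part_0_real ghost_part_S[OF real_ghost[OF Suc.prems(1)] e'(1)] by blast
      ultimately have "x * S e \<in> J" by (rule real_in_J)
      then show ?thesis
        using e'(1) by (rule gens_J)
    qed
    moreover have "x * q v F = x * q v F' +
        (\<Sum>e\<in>F' \<inter> out_edges G v - F \<inter> out_edges G v. x * S e * S' e)"
    proof -
      have "(\<Sum>e\<in>F' \<inter> out_edges G v. S e * S' e) =
          (\<Sum>e\<in>F' \<inter> out_edges G v - F \<inter> out_edges G v. S e * S' e) +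
          (\<Sum>e\<in>F \<inter> out_edges G v. S e * S' e)"
        using F' by (intro sum.subset_diff) auto
      then show ?thesis
        by (simp add: q_def right_diff_distrib distrib_left sum_distrib_left mult.assoc)
    qed
    ultimately show ?thesis
      by (simp only: subspace_add[OF sub_J] subspace_sum[OF sub_J])
  qed
qed

text \<open>Induction on the length of the ghost paths. A right unit \<open>C\<close> is split at
  the sources of a finite edge set \<open>F\<close> beyond which \<open>x\<close> agrees with some
  \<open>y\<close> without ghost edges.\<close>

lemma in_J:
  assumes "x \<in> I" "x \<in> ghost_part n"
  shows "x \<in> J"
  using assms
proof (induction n arbitrary: x)
  case 0
  then show ?case using ghost_part_0_real real_in_J by blast
next
  case (Suc n)
  obtain C where C: "C \<in> gen_verts G" "x * P C = x"
    using right_unit[OF Suc.prems(2)] by blast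
  obtain m y F where y: "y \<in> real_part m" and F: "finite F" "F \<subseteq> edges G"
      and xq: "\<And>v. v \<in> verts G \<Longrightarrow> x * q v F = y * q v F"
      and xP: "\<And>B. \<lbrakk>B \<in> gen_verts G; \<forall>e\<in>F. src G e \<notin> B\<rbrakk> \<Longrightarrow> x * P B = y * P B"
    using ghost_part_real_agree[OF Suc.prems(2)] by (metis order_refl)
  define W where "W = src G ` F \<inter> C"
  have C': "C - W \<in> gen_verts G" "P C = P (C - W) + (\<Sum>w\<in>W. P {w})"
    using P_remove_finite[of W C] F(1) C(1) by (auto simp: W_def)
  \<comment> \<open>No edge of \<open>F\<close> starts in \<open>C - W\<close>, so the ghost terms
    vanish here.\<close>
  have "x * P (C - W) = y * P (C - W)"
    using xP C'(1) by (auto simp: W_def)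
  then have first: "x * P (C - W) \<in> J"
    using real_part_P[OF y C'(1)] gens_I(2)[OF Suc.prems(1) C'(1)] by (auto intro: real_in_J)
  have "x * P {w} \<in> J" if "w \<in> W" for w
  proof -
    have w: "w \<in> verts G"
      using that gen_verts_subset[OF ultragraph C(1)] by (auto simp: W_def)
    have "x * q w F \<in> I"
      using Suc.prems(1) F(2) w by (rule absorbing_q[OF I])
    then have "x * q w F \<in> J"
      unfolding xq[OF w] by (rule real_q_in_J[OF y w F])
    \<comment> \<open>Multiplying by \<open>S e\<close> shortens the ghost paths; together with
      \<open>x * q w F\<close> these products recover \<open>x * P {w}\<close>.\<close>
    moreover have "x * S e \<in> J" if "e \<in> edges G" for e
      using that Suc.prems by (intro Suc.IH ghost_part_S gens_I)
    then have "(\<Sum>e\<in>F \<inter> out_edges G w. x * S e * S' e) \<in> J"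
      using F(2) by (intro subspace_sum[OF sub_J] gens_J(6)) auto
    moreover have "x * P {w} = x * q w F + (\<Sum>e\<in>F \<inter> out_edges G w. x * S e * S' e)"
      by (simp add: q_def right_diff_distrib sum_distrib_left mult.assoc)
    ultimately show ?thesis
      by (simp add: subspace_add[OF sub_J])
  qed
  then have "x * P C \<in> J"
    using first by (simp add: C'(2) distrib_left sum_distrib_left subspace_add[OF sub_J]
          subspace_sum[OF sub_J])
  then show ?case by (simp add: C)
qed

end


section \<open>The ultragraph Leavitt path algebra inside a ring type\<close>

text \<open>\<open>L\<^sub>K(\<G>)\<close> is a quotient that depends on the term \<open>\<G>\<close>, so it is not a type. The product of
  these quotients over all ultragraphs on the same vertex and edge types is one, and each
  \<open>L\<^sub>K(\<G>)\<close> embeds into it as a factor. Relations then become equations in a type of class \<open>ring\<close>.\<close>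

definition lpa_rel ::
    "(('v, 'e) ultragraph \<Rightarrow> ('v, 'e, 'k::field) free_alg) \<Rightarrow>
     (('v, 'e) ultragraph \<Rightarrow> ('v, 'e, 'k) free_alg) \<Rightarrow> bool" where
  "lpa_rel f g \<longleftrightarrow>
     (\<forall>H. f H \<in> free_carrier H \<and> g H \<in> free_carrier H \<and> f H - g H \<in> relation_ideal H)"

lemma part_equivp_lpa_rel:
  "part_equivp (lpa_rel :: (('v, 'e) ultragraph \<Rightarrow> ('v, 'e, 'k::field) free_alg) \<Rightarrow> _)"
proof (rule part_equivpI)
  let ?R = "lpa_rel :: (('v, 'e) ultragraph \<Rightarrow> ('v, 'e, 'k) free_alg) \<Rightarrow> _"
  show "\<exists>f. ?R f f"
    by (intro exI[of _ "\<lambda>_. 0"]) (simp add: lpa_rel_def free_carrier_0 relation_ideal.zero)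
  show "symp ?R"
  proof (rule sympI)
    fix f g :: "('v, 'e) ultragraph \<Rightarrow> ('v, 'e, 'k) free_alg"
    assume fg: "lpa_rel f g"
    have "g H - f H \<in> relation_ideal H" for H
      using fg relation_ideal_uminus[of "f H - g H" H] by (simp add: lpa_rel_def)
    then show "lpa_rel g f"
      using fg by (simp add: lpa_rel_def)
  qed
  show "transp ?R"
  proof (rule transpI)
    fix f g h :: "('v, 'e) ultragraph \<Rightarrow> ('v, 'e, 'k) free_alg"
    assume fg: "lpa_rel f g" and gh: "lpa_rel g h"
    have "f H - h H \<in> relation_ideal H" for H
      using fg gh relation_ideal.add[of "f H - g H" H "g H - h H"] by (simp add: lpa_rel_def)
    then show "lpa_rel f h"
      using fg gh by (simp add: lpa_rel_def)
  qed
qed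

quotient_type (overloaded) ('v, 'e, 'k) lpa_prod =
  "('v, 'e) ultragraph \<Rightarrow> ('v, 'e, 'k::field) free_alg" / partial: lpa_rel
  by (rule part_equivp_lpa_rel)

instantiation lpa_prod :: (type, type, field) ring
begin

lift_definition zero_lpa_prod :: "('a, 'b, 'c) lpa_prod" is "\<lambda>_. 0"
  by (simp add: lpa_rel_def free_carrier_0 relation_ideal.zero)

lift_definition plus_lpa_prod ::
    "('a, 'b, 'c) lpa_prod \<Rightarrow> ('a, 'b, 'c) lpa_prod \<Rightarrow> ('a, 'b, 'c) lpa_prod" is
  "\<lambda>f g H. f H + g H"
proof -
  fix f f' g g' :: "('a, 'b) ultragraph \<Rightarrow> ('a, 'b, 'c) free_alg"
  assume *: "lpa_rel f f'" "lpa_rel g g'"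
  have "f H + g H - (f' H + g' H) \<in> relation_ideal H" for H
    using * relation_ideal.add[of "f H - f' H" H "g H - g' H"]
    by (simp add: lpa_rel_def algebra_simps)
  then show "lpa_rel (\<lambda>H. f H + g H) (\<lambda>H. f' H + g' H)"
    using * by (simp add: lpa_rel_def free_carrier_add)
qed

lift_definition uminus_lpa_prod :: "('a, 'b, 'c) lpa_prod \<Rightarrow> ('a, 'b, 'c) lpa_prod" is
  "\<lambda>f H. - f H"
proof -
  fix f f' :: "('a, 'b) ultragraph \<Rightarrow> ('a, 'b, 'c) free_alg"
  assume *: "lpa_rel f f'"
  have "- f H - - f' H \<in> relation_ideal H" for H
    using * relation_ideal_uminus[of "f H - f' H" H] by (simp add: lpa_rel_def)
  then show "lpa_rel (\<lambda>H. - f H) (\<lambda>H. - f' H)"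
    using * by (simp add: lpa_rel_def free_carrier_uminus)
qed

lift_definition minus_lpa_prod ::
    "('a, 'b, 'c) lpa_prod \<Rightarrow> ('a, 'b, 'c) lpa_prod \<Rightarrow> ('a, 'b, 'c) lpa_prod" is
  "\<lambda>f g H. f H - g H"
proof -
  fix f f' g g' :: "('a, 'b) ultragraph \<Rightarrow> ('a, 'b, 'c) free_alg"
  assume *: "lpa_rel f f'" "lpa_rel g g'"
  have "f H - g H - (f' H - g' H) \<in> relation_ideal H" for H
    using * relation_ideal_diff[of "f H - f' H" H "g H - g' H"]
    by (simp add: lpa_rel_def algebra_simps)
  then show "lpa_rel (\<lambda>H. f H - g H) (\<lambda>H. f' H - g' H)"
    using * by (simp add: lpa_rel_def free_carrier_diff)
qed

lift_definition times_lpa_prod ::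
    "('a, 'b, 'c) lpa_prod \<Rightarrow> ('a, 'b, 'c) lpa_prod \<Rightarrow> ('a, 'b, 'c) lpa_prod" is
  "\<lambda>f g H. f H * g H"
proof -
  fix f f' g g' :: "('a, 'b) ultragraph \<Rightarrow> ('a, 'b, 'c) free_alg"
  assume *: "lpa_rel f f'" "lpa_rel g g'"
  have "(f H - f' H) * g H + f' H * (g H - g' H) \<in> relation_ideal H" for H
    using * by (intro relation_ideal.add relation_ideal.left relation_ideal.right)
      (simp_all add: lpa_rel_def)
  then have "f H * g H - f' H * g' H \<in> relation_ideal H" for H
    by (simp add: algebra_simps)
  then show "lpa_rel (\<lambda>H. f H * g H) (\<lambda>H. f' H * g' H)"
    using * by (simp add: lpa_rel_def free_carrier_mult)
qed

instance
  by standard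
    (transfer, simp add: lpa_rel_def algebra_simps relation_ideal.zero free_carrier_0
      free_carrier_add free_carrier_mult free_carrier_uminus free_carrier_diff)+

end

section \<open>Scalars and the embedding of one factor\<close>

lift_definition lpa_scale ::
    "'k::field \<Rightarrow> ('v, 'e, 'k) lpa_prod \<Rightarrow> ('v, 'e, 'k) lpa_prod" is
  "\<lambda>k f H. scale k (f H)"
proof -
  fix k and f f' :: "('v, 'e) ultragraph \<Rightarrow> ('v, 'e, 'k) free_alg"
  assume *: "lpa_rel f f'"
  have "scale k (f H) - scale k (f' H) \<in> relation_ideal H" for H
    using * relation_ideal.scale[of "f H - f' H" H k]
    by (simp add: lpa_rel_def scale_eq right_diff_distrib)
  then show "lpa_rel (\<lambda>H. scale k (f H)) (\<lambda>H. scale k (f' H))"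
    using * by (simp add: lpa_rel_def free_carrier_scale)
qed

text \<open>The default 0 keeps every component inside its free carrier, so the map is total; it is
  a homomorphism on \<open>free_carrier G\<close>.\<close>

lift_definition embed ::
    "('v, 'e) ultragraph \<Rightarrow> ('v, 'e, 'k::field) free_alg \<Rightarrow> ('v, 'e, 'k) lpa_prod" is
  "\<lambda>G x H. if H = G \<and> x \<in> free_carrier G then x else 0"
  by (simp add: lpa_rel_def free_carrier_0 relation_ideal.zero)

lemma embed_eq_iff:
  fixes x y :: "('v, 'e, 'k::field) free_alg"
  assumes "x \<in> free_carrier G" "y \<in> free_carrier G"
  shows "embed G x = embed G y \<longleftrightarrow> x - y \<in> relation_ideal G"
proof (transfer fixing: x y G)
  note xy = assms
  let ?f = "\<lambda>x H. if H = G \<and> x \<in> free_carrier G then x else 0"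
  show "lpa_rel (?f x) (?f y) \<longleftrightarrow> x - y \<in> relation_ideal G"
  proof
    assume "lpa_rel (?f x) (?f y)"
    then have "?f x G - ?f y G \<in> relation_ideal G"
      unfolding lpa_rel_def by blast
    then show "x - y \<in> relation_ideal G"
      using xy by simp
  qed (use xy in \<open>simp add: lpa_rel_def free_carrier_0 relation_ideal.zero\<close>)
qed

lemma embed_0: "embed G 0 = 0"
  by transfer (simp add: lpa_rel_def free_carrier_0 relation_ideal.zero)

lemma scale_0: "scale k 0 = 0"
  by (simp add: scale_eq)

lemma embed_hom:
  assumes "x \<in> free_carrier G"
  shows "y \<in> free_carrier G \<Longrightarrow> embed G (x + y) = embed G x + embed G y"
    and "y \<in> free_carrier G \<Longrightarrow> embed G (x - y) = embed G x - embed G y"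
    and "y \<in> free_carrier G \<Longrightarrow> embed G (x * y) = embed G x * embed G y"
    and "embed G (scale k x) = lpa_scale k (embed G x)"
  using assms
  by (transfer; simp add: lpa_rel_def free_carrier_0 free_carrier_add free_carrier_diff
      free_carrier_mult free_carrier_scale relation_ideal.zero scale_0)+

lemma embed_sum:
  "(\<And>i. i \<in> T \<Longrightarrow> f i \<in> free_carrier G) \<Longrightarrow> embed G (sum f T) = (\<Sum>i\<in>T. embed G (f i))"
  by (induction T rule: infinite_finite_induct)
    (auto simp: embed_0 embed_hom free_carrier_sum)

lemma scale_mult_left: "scale k x * y = scale k (x * y)"
  by (simp add: scale_eq mult.assoc)

text \<open>Words do not commute with each other, but the index 0 is the empty word and the
  coefficients come from a field.\<close>

lemma single_0_commute:
  fixes x :: "('v, 'e, 'k::field) free_alg"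
  shows "x * Poly_Mapping.single 0 k = Poly_Mapping.single 0 k * x"
proof -
  have *: "x = (\<Sum>w\<in>Poly_Mapping.keys x. Poly_Mapping.single w (Poly_Mapping.lookup x w))"
    by (rule poly_mapping_eqI)
      (simp add: lookup_sum lookup_single when_def in_keys_iff cong: if_cong)
  show ?thesis
    by (subst (1 2) *) (simp add: sum_distrib_left sum_distrib_right mult_single mult.commute)
qed

lemma scale_mult_right: "x * scale k y = scale k (x * y)"
  by (simp add: scale_eq mult.assoc[symmetric] single_0_commute)

lemma module_lpa_scale: "module (lpa_scale :: 'k::field \<Rightarrow> ('v, 'e, 'k) lpa_prod \<Rightarrow> _)"
proof
  fix a b :: 'k and x y :: "('v, 'e, 'k) lpa_prod"
  show "lpa_scale a (x + y) = lpa_scale a x + lpa_scale a y"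
    by transfer (simp add: lpa_rel_def scale_eq algebra_simps relation_ideal.zero
        free_carrier_add free_carrier_scale[unfolded scale_eq])
  show "lpa_scale (a + b) x = lpa_scale a x + lpa_scale b x"
    by transfer (simp add: lpa_rel_def scale_eq algebra_simps relation_ideal.zero single_add
        free_carrier_add free_carrier_scale[unfolded scale_eq])
  show "lpa_scale a (lpa_scale b x) = lpa_scale (a * b) x"
    by transfer (simp add: lpa_rel_def scale_eq mult.assoc[symmetric] mult_single
        relation_ideal.zero free_carrier_scale[unfolded scale_eq])
  show "lpa_scale 1 x = x"
    by transfer (simp add: lpa_rel_def scale_eq relation_ideal.zero)
qed

lemma lpa_family_embed:
  fixes G :: "('v, 'e) ultragraph"
  assumes "is_ultragraph G"
  shows "lpa_family (lpa_scale :: 'k::field \<Rightarrow> _) G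
    (\<lambda>A. embed G (pf A)) (\<lambda>e. embed G (sf e)) (\<lambda>e. embed G (sf' e))"
proof -
  interpret module "lpa_scale :: 'k \<Rightarrow> ('v, 'e, 'k) lpa_prod \<Rightarrow> _"
    by (rule module_lpa_scale)
  have rel: "embed G x = embed G y"
    if "x - y \<in> relators G" "x \<in> free_carrier G" "y \<in> free_carrier G"
    for x y :: "('v, 'e, 'k) free_alg"
    using that by (simp add: embed_eq_iff relation_ideal.relator)
  note closed = free_carrier_gens free_carrier_mult free_carrier_add free_carrier_diff
    free_carrier_0 gen_verts.intros
  have src: "{src G e} \<in> gen_verts G" if "e \<in> edges G" for e
    using that assms by (auto simp: is_ultragraph_def intro: gen_verts.vertex)
  show ?thesis
  proof
    show "is_ultragraph G" by fact
    show "embed G (pf {}) = (0 :: ('v, 'e, 'k) lpa_prod)"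
      using rel[of "pf {}" 0] by (simp add: relators.empty closed embed_0)
  next
    fix k :: 'k and x y :: "('v, 'e, 'k) lpa_prod"
    show "lpa_scale k x * y = lpa_scale k (x * y)"
      by transfer (simp add: lpa_rel_def scale_mult_left relation_ideal.zero free_carrier_mult
          free_carrier_scale)
    show "x * lpa_scale k y = lpa_scale k (x * y)"
      by transfer (simp add: lpa_rel_def scale_mult_right relation_ideal.zero free_carrier_mult
          free_carrier_scale)
  next
    fix A B assume "A \<in> gen_verts G" "B \<in> gen_verts G"
    then show
      "embed G (pf A) * embed G (pf B) = (embed G (pf (A \<inter> B)) :: ('v, 'e, 'k) lpa_prod)"
      "embed G (pf (A \<union> B)) =
        (embed G (pf A) + embed G (pf B) - embed G (pf (A \<inter> B)) :: ('v, 'e, 'k) lpa_prod)"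
      using rel[OF relators.inter[of A G B]] rel[OF relators.union[of A G B]]
      by (simp_all add: embed_hom closed)
  next
    fix e assume "e \<in> edges G"
    then show
      "embed G (pf {src G e}) * embed G (sf e) = (embed G (sf e) :: ('v, 'e, 'k) lpa_prod)"
      "embed G (sf e) * embed G (pf (rng G e)) = (embed G (sf e) :: ('v, 'e, 'k) lpa_prod)"
      "embed G (pf (rng G e)) * embed G (sf' e) = (embed G (sf' e) :: ('v, 'e, 'k) lpa_prod)"
      "embed G (sf' e) * embed G (pf {src G e}) = (embed G (sf' e) :: ('v, 'e, 'k) lpa_prod)"
      using rel[OF relators.src_s[of e G]] rel[OF relators.s_rng[of e G]]
        rel[OF relators.rng_s'[of e G]] rel[OF relators.s'_src[of e G]] src[of e]
      by (simp_all add: embed_hom closed)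
  next
    fix e f assume "e \<in> edges G" "f \<in> edges G"
    then show "embed G (sf' e) * embed G (sf f) =
        (if e = f then embed G (pf (rng G e)) else (0 :: ('v, 'e, 'k) lpa_prod))"
      using rel[OF relators.ck1[of e G f]]
      by (simp add: embed_hom closed embed_0 split: if_splits)
  qed
qed

section \<open>Normal form and ideals in the embedded algebra\<close>

definition preimage_ideal ::
    "('v, 'e) ultragraph \<Rightarrow> ('v, 'e, 'k::field) free_alg set set \<Rightarrow> ('v, 'e, 'k) lpa_prod set" where
  "preimage_ideal G I = embed G ` {x \<in> free_carrier G. lpa_class G x \<in> I}"

lemma embed_in_preimage_ideal:
  assumes "x \<in> free_carrier G"
  shows "embed G x \<in> preimage_ideal G I \<longleftrightarrow> lpa_class G x \<in> I"
proof
  assume "embed G x \<in> preimage_ideal G I"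
  then obtain y where "y \<in> free_carrier G" "lpa_class G y \<in> I" "embed G x = embed G y"
    by (auto simp: preimage_ideal_def)
  then show "lpa_class G x \<in> I"
    using assms lpa_class_eqI[of x y G] by (simp add: embed_eq_iff)
qed (use assms in \<open>auto simp: preimage_ideal_def\<close>)

lemma sf_path_append: "sf_path (p @ r) = sf_path p * sf_path r"
  by (simp add: sf_path_def)

lemma sf_path_power: "sf_path c ^ j = sf_path (concat (replicate j c))"
  by (induction j) (simp_all add: sf_path_append, simp add: sf_path_def)

text \<open>The parameter \<open>K\<close> carries no data; it ties the field type to the
  locale.\<close>

locale lpa_embedding =
  fixes G :: "('v, 'e) ultragraph" and K :: "'k::field itself"
  assumes ug: "is_ultragraph G"
begin

sublocale L: lpa_family "lpa_scale :: 'k \<Rightarrow> ('v, 'e, 'k) lpa_prod \<Rightarrow> _" G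
    "\<lambda>A. embed G (pf A)" "\<lambda>e. embed G (sf e)" "\<lambda>e. embed G (sf' e)"
  by (rule lpa_family_embed[OF ug])

lemma embed_gen_in_ghost_part:
  assumes "a \<in> generators G"
  shows "embed G (gen a) \<in> L.ghost_part 1"
proof -
  have "embed G (pf A) \<in> L.ghost_part n" if "A \<in> gen_verts G" for A n
    using L.sp_ghost[of "[]" A] that by (simp add: L.sp_simps)
  moreover have "embed G (sf e) \<in> L.ghost_part n" if "e \<in> edges G" for e n
    using L.sp_ghost[of "[e]" "rng G e"] that by (simp add: L.sp_simps L.rel)
  moreover have "embed G (sf' e) \<in> L.ghost_part 1" if "e \<in> edges G" for e
    using L.ghost_part_S'[OF calculation(1)[of "rng G e" 0], of e] that by (simp add: L.rel)
  ultimately show ?thesis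
    using assms by (auto simp: generators_def)
qed

lemma ghost_part_gen:
  assumes "x \<in> L.ghost_part n" "a \<in> generators G"
  shows "x * embed G (gen a) \<in> L.ghost_part (Suc n)"
proof -
  have *: "x \<in> L.ghost_part (Suc n)" "x \<in> L.ghost_part (Suc (Suc n))"
      "L.ghost_part n \<subseteq> L.ghost_part (Suc n)"
    using assms(1) L.ghost_part_mono[of n "Suc n"] L.ghost_part_mono[of n "Suc (Suc n)"] by auto
  show ?thesis
    using assms * L.ghost_part_S[of x n]
    by (auto simp: generators_def intro: L.ghost_part_P L.ghost_part_S')
qed

text \<open>The normal form of a monomial, built by appending letters on the right. Each letter
  lengthens the ghost paths by at most one.\<close>

lemma single_in_ghost_part:
  "\<lbrakk>l \<noteq> []; set l \<subseteq> generators G\<rbrakk> \<Longrightarrow>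
    \<exists>n. embed G (Poly_Mapping.single (FMon l) (1::'k)) \<in> L.ghost_part n"
proof (induction l rule: rev_nonempty_induct)
  case (single a)
  then show ?case using embed_gen_in_ghost_part[of a] by (auto simp: gen_def)
next
  case (snoc a l)
  have "Poly_Mapping.single (FMon (l @ [a])) (1::'k) = Poly_Mapping.single (FMon l) 1 * gen a"
    by (simp add: gen_def mult_single plus_fmon_def)
  moreover have "Poly_Mapping.single (FMon l) (1::'k) \<in> free_carrier G"
    using snoc by (simp add: free_carrier_def)
  moreover obtain n where "embed G (Poly_Mapping.single (FMon l) (1::'k)) \<in> L.ghost_part n"
    using snoc by auto
  moreover have "(gen a :: ('v, 'e, 'k) free_alg) \<in> free_carrier G"
    using snoc.prems by (intro free_carrier_gen) simp
  ultimately show ?case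
    using snoc.prems ghost_part_gen[of _ n a]
    by (intro exI[of _ "Suc n"]) (simp add: embed_hom)
qed

lemma embed_in_ghost_part:
  assumes x: "x \<in> free_carrier G"
  shows "\<exists>n. embed G (x :: ('v, 'e, 'k) free_alg) \<in> L.ghost_part n"
proof -
  let ?t = "\<lambda>w. scale (Poly_Mapping.lookup x w) (Poly_Mapping.single w 1)"
  have expand: "x = (\<Sum>w\<in>Poly_Mapping.keys x. ?t w)"
    by (rule poly_mapping_eqI)
      (simp add: scale_eq mult_single lookup_sum lookup_single when_def in_keys_iff cong: if_cong)
  have w: "\<exists>n. embed G (Poly_Mapping.single w (1::'k)) \<in> L.ghost_part n"
      "Poly_Mapping.single w (1::'k) \<in> free_carrier G"
    if "w \<in> Poly_Mapping.keys x" for w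
    using x that single_in_ghost_part[of "letters w"] by (auto simp: free_carrier_def)
  have "\<exists>n. (\<Sum>w\<in>T. embed G (?t w)) \<in> L.ghost_part n"
    if "finite T" "T \<subseteq> Poly_Mapping.keys x" for T
    using that
  proof (induction T rule: finite_induct)
    case empty
    then show ?case using L.subspace_0[OF L.subspace_parts(3)] by auto
  next
    case (insert w T)
    obtain m n where "embed G (Poly_Mapping.single w (1::'k)) \<in> L.ghost_part m"
        "(\<Sum>w\<in>T. embed G (?t w)) \<in> L.ghost_part n"
      using insert w(1)[of w] by auto
    then have "embed G (Poly_Mapping.single w (1::'k)) \<in> L.ghost_part (max m n)"
        "(\<Sum>w\<in>T. embed G (?t w)) \<in> L.ghost_part (max m n)"
      using L.ghost_part_mono[of m "max m n"] L.ghost_part_mono[of n "max m n"] by auto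
    then have "(\<Sum>w\<in>insert w T. embed G (?t w)) \<in> L.ghost_part (max m n)"
      using insert w(2)[of w]
      by (simp add: embed_hom L.subspace_add L.subspace_scale L.subspace_parts(3))
    then show ?case by blast
  qed
  moreover have "embed G x = (\<Sum>w\<in>Poly_Mapping.keys x. embed G (?t w))"
    by (subst expand, rule embed_sum) (use w in \<open>auto intro: free_carrier_scale\<close>)
  ultimately show ?thesis by simp
qed

lemma absorbing_preimage_ideal:
  assumes I: "two_sided_ideal (LPA G) (I :: ('v, 'e, 'k) free_alg set set)"
  shows "L.absorbing (preimage_ideal G I)"
proof -
  have carrier: "acarrier (LPA G) = lpa_class G ` free_carrier G" and zero: "azero (LPA G) = lpa_class G 0"
    by (simp_all add: LPA_def)
  have mult: "embed G (a * x) \<in> preimage_ideal G I" "embed G (x * a) \<in> preimage_ideal G I"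
    if "x \<in> free_carrier G" "lpa_class G x \<in> I" "a \<in> free_carrier G"
    for a x :: "('v, 'e, 'k) free_alg"
    using I that LPA_mult[of a G x] LPA_mult[of x G a]
    by (force simp: two_sided_ideal_def carrier embed_in_preimage_ideal free_carrier_mult)+
  have "L.subspace (preimage_ideal G I)"
  proof (rule L.subspaceI)
    show "0 \<in> preimage_ideal G I"
      using I embed_in_preimage_ideal[of 0 G I]
      by (simp add: two_sided_ideal_def embed_0 zero free_carrier_0)
  next
    fix x y assume "x \<in> preimage_ideal G I" "y \<in> preimage_ideal G I"
    then obtain x' y' where xy: "x = embed G x'" "y = embed G y'" "x' \<in> free_carrier G"
        "y' \<in> free_carrier G" "lpa_class G x' \<in> I" "lpa_class G y' \<in> I"
      by (auto simp: preimage_ideal_def)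
    then have "aadd (LPA G) (lpa_class G x') (lpa_class G y') \<in> I"
      using I by (simp add: two_sided_ideal_def)
    then show "x + y \<in> preimage_ideal G I"
      using xy embed_in_preimage_ideal[of "x' + y'" G I]
      by (simp add: LPA_add embed_hom free_carrier_add)
  next
    fix k x assume "x \<in> preimage_ideal G I"
    then obtain x' where x': "x = embed G x'" "x' \<in> free_carrier G" "lpa_class G x' \<in> I"
      by (auto simp: preimage_ideal_def)
    \<comment> \<open>Ring ideals are not assumed closed under scalars. A local left unit turns
      scaling by \<open>k\<close> into multiplication by the algebra element
      \<open>scale k (pf C)\<close>.\<close>
    obtain C where C: "C \<in> gen_verts G" "embed G (pf C) * x = x"
      using embed_in_ghost_part[OF x'(2)] L.left_unit unfolding x'(1) by blast
    have "lpa_scale k x = lpa_scale k (embed G (pf C)) * x"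
      by (simp add: L.sm_mult_left C)
    also have "\<dots> = embed G (scale k (pf C) * x')"
      using C x' by (simp add: embed_hom free_carrier_gens free_carrier_scale)
    finally show "lpa_scale k x \<in> preimage_ideal G I"
      using mult(1)[OF x'(2,3)] C by (simp add: free_carrier_gens free_carrier_scale)
  qed
  moreover have "embed G a * x \<in> preimage_ideal G I \<and> x * embed G a \<in> preimage_ideal G I"
    if "x \<in> preimage_ideal G I" "a \<in> free_carrier G" for a x
    using that mult by (auto simp: preimage_ideal_def[of G I] embed_hom[symmetric])
  ultimately show ?thesis
    by (simp add: L.absorbing_def free_carrier_gens)
qed

lemma embed_path:
  "\<lbrakk>set p \<subseteq> edges G; A \<in> gen_verts G\<rbrakk> \<Longrightarrow>
    embed G (sf_path p * pf A) = (L.sp p A :: ('v, 'e, 'k) lpa_prod)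
    \<and> (sf_path p * pf A :: ('v, 'e, 'k) free_alg) \<in> free_carrier G"
  by (induction p)
    (auto simp: sf_path_def L.sp_simps mult.assoc embed_hom free_carrier_gens free_carrier_mult)

lemma embed_q:
  assumes "v \<in> verts G"
  shows "embed G (pf {v} - (\<Sum>e\<in>F \<inter> out_edges G v. sf e * sf' e)) =
      (L.q v F :: ('v, 'e, 'k) lpa_prod)"
    and "(pf {v} - (\<Sum>e\<in>F \<inter> out_edges G v. sf e * sf' e) :: ('v, 'e, 'k) free_alg) \<in> free_carrier G"
proof -
  have *: "(sf e * sf' e :: ('v, 'e, 'k) free_alg) \<in> free_carrier G \<and>
      embed G (sf e * sf' e) = (embed G (sf e) * embed G (sf' e) :: ('v, 'e, 'k) lpa_prod)"
    if "e \<in> F \<inter> out_edges G v" for e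
    using that by (simp add: out_edges_def embed_hom free_carrier_gens free_carrier_mult)
  have sum: "(\<Sum>e\<in>F \<inter> out_edges G v. sf e * sf' e :: ('v, 'e, 'k) free_alg) \<in> free_carrier G"
    using * by (intro free_carrier_sum) blast
  have v: "(pf {v} :: ('v, 'e, 'k) free_alg) \<in> free_carrier G"
    using assms by (intro free_carrier_gens gen_verts.vertex)
  have "embed G (\<Sum>e\<in>F \<inter> out_edges G v. sf e * sf' e) =
      (\<Sum>e\<in>F \<inter> out_edges G v. embed G (sf e) * embed G (sf' e) :: ('v, 'e, 'k) lpa_prod)"
    using * by (subst embed_sum) (auto intro!: sum.cong)
  then show "embed G (pf {v} - (\<Sum>e\<in>F \<inter> out_edges G v. sf e * sf' e)) =
      (L.q v F :: ('v, 'e, 'k) lpa_prod)"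
    using v sum by (simp add: embed_hom(2) L.q_def)
  show "(pf {v} - (\<Sum>e\<in>F \<inter> out_edges G v. sf e * sf' e) :: ('v, 'e, 'k) free_alg) \<in> free_carrier G"
    using v sum by (rule free_carrier_diff)
qed

end

section \<open>Special elements and the theorem\<close>

definition special_generator ::
    "('v, 'e) ultragraph \<Rightarrow> ('v, 'e, 'k::field) free_alg set \<Rightarrow> bool" where
  "special_generator G x \<longleftrightarrow> (\<exists>A v S c (m::nat) (k::nat \<Rightarrow> 'k) (r::nat \<Rightarrow> nat).
       A \<in> gen_verts G \<and> v \<in> A \<and>
       finite S \<and> S \<subseteq> edges G \<and> (\<forall>e\<in>S. src G e = v) \<and>
       (\<forall>i\<in>{1..m}. 0 < r i) \<and>
       ((\<exists>i\<in>{2..m}. k i \<noteq> 0) \<longrightarrow>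
          cycle_at G v c \<and> A \<subseteq> path_rng G c \<and>
          (\<forall>d. cycle_at G v d \<and> A \<subseteq> path_rng G d \<longrightarrow> d = c)) \<and>
       x = lpa_class G
             ((pf A + (\<Sum>i=2..m. scale (k i) (sf_path c ^ r i))) *
              (pf A - (\<Sum>e\<in>S. sf e * sf' e))))"

lemma special_generatorI:
  fixes m :: nat and k :: "nat \<Rightarrow> 'k::field" and r :: "nat \<Rightarrow> nat"
  assumes "A \<in> gen_verts G" "v \<in> A" "finite S" "S \<subseteq> edges G" "\<forall>e\<in>S. src G e = v"
    "\<forall>i\<in>{1..m}. 0 < r i"
    "(\<exists>i\<in>{2..m}. k i \<noteq> 0) \<longrightarrow> cycle_at G v c \<and> A \<subseteq> path_rng G c \<and>
      (\<forall>d. cycle_at G v d \<and> A \<subseteq> path_rng G d \<longrightarrow> d = c)"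
    and z: "z = (pf A + (\<Sum>i=2..m. scale (k i) (sf_path c ^ r i))) * (pf A - (\<Sum>e\<in>S. sf e * sf' e))"
  shows "special_generator G (lpa_class G z)"
  unfolding special_generator_def z
  by (intro exI[of _ A] exI[of _ v] exI[of _ S] exI[of _ c] exI[of _ m] exI[of _ k] exI[of _ r]
      conjI assms(1-7) refl)

text \<open>With \<open>J\<close> ranging over all ideals that contain the special elements of
  \<open>I\<close>, this bounds the generated ideal from below. The work is to write the three kinds
  of elements in \<open>lpa_ideals\<close> as special ones.\<close>

lemma (in lpa_embedding) ideal_subset:
  fixes I J :: "('v, 'e, 'k) free_alg set set"
  assumes I: "two_sided_ideal (LPA G) I" and J: "two_sided_ideal (LPA G) J"
    and gens: "\<And>x. \<lbrakk>x \<in> I; special_generator G x\<rbrakk> \<Longrightarrow> x \<in> J"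
  shows "I \<subseteq> J"
proof -
  \<comment> \<open>\<open>z\<close> is the two-factor form that \<open>special_generator\<close>
    asks for, \<open>y\<close> a simpler representative of the same class.\<close>
  have transfer_gen: "embed G y \<in> preimage_ideal G J"
    if "special_generator G (lpa_class G z)" "embed G z = embed G y"
      "y \<in> free_carrier G" "z \<in> free_carrier G" "embed G y \<in> preimage_ideal G I"
    for y z :: "('v, 'e, 'k) free_alg"
  proof -
    have "lpa_class G z = lpa_class G y"
      using that by (intro lpa_class_eqI) (simp add: embed_eq_iff)
    then show ?thesis
      using that gens by (simp add: embed_in_preimage_ideal)
  qed
  interpret lpa_ideals "lpa_scale :: 'k \<Rightarrow> ('v, 'e, 'k) lpa_prod \<Rightarrow> _" G
    "\<lambda>A. embed G (pf A)" "\<lambda>e. embed G (sf e)" "\<lambda>e. embed G (sf' e)"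
    "preimage_ideal G I" "preimage_ideal G J"
  proof
    show "L.absorbing (preimage_ideal G I)" "L.absorbing (preimage_ideal G J)"
      using I J by (simp_all add: absorbing_preimage_ideal)
  next
    fix A assume A: "A \<in> gen_verts G" "A \<noteq> {}"
      and PA: "embed G (pf A) \<in> preimage_ideal G I"
    \<comment> \<open>With \<open>m = 1\<close> the sum from 2 is empty, and \<open>S\<close> is
      empty too. The vertex \<open>v\<close> is an arbitrary element of \<open>A\<close>.\<close>
    let ?z = "pf A * pf A :: ('v, 'e, 'k) free_alg"
    obtain v where "v \<in> A" using A by blast
    then have "special_generator G (lpa_class G ?z)"
      using A(1)
      by (intro special_generatorI[where S = "{}" and m = 1 and r = "\<lambda>_. 1" and k = "\<lambda>_. 0"]) auto
    then show "embed G (pf A) \<in> preimage_ideal G J"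
      using A PA by (elim transfer_gen) (auto simp: embed_hom free_carrier_gens free_carrier_mult L.rel)
  next
    fix v F assume v: "v \<in> verts G" and F: "finite F" "F \<subseteq> edges G"
      and q: "L.q v F \<in> preimage_ideal G I"
    let ?y = "pf {v} - (\<Sum>e\<in>F \<inter> out_edges G v. sf e * sf' e) :: ('v, 'e, 'k) free_alg"
    \<comment> \<open>The first factor reduces to \<open>pf {v}\<close> and is absorbed by
      \<open>L.P_q\<close>.\<close>
    let ?z = "pf {v} * ?y"
    have "special_generator G (lpa_class G ?z)"
      using v F
      by (intro special_generatorI[where v = v and m = 1 and r = "\<lambda>_. 1" and k = "\<lambda>_. 0"])
        (auto simp: out_edges_def intro: gen_verts.vertex)
    then have "embed G ?y \<in> preimage_ideal G J"
    proof (rule transfer_gen)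
      show "embed G ?z = embed G ?y"
        using v F by (simp add: embed_hom(3) embed_q free_carrier_gens gen_verts.vertex L.P_q)
    qed (use v q in \<open>auto simp: embed_q free_carrier_gens gen_verts.vertex free_carrier_mult\<close>)
    then show "L.q v F \<in> preimage_ideal G J"
      using v by (simp add: embed_q)
  next
    fix w c M and \<kappa> :: "nat \<Rightarrow> 'k"
    assume w: "w \<in> verts G" and c: "cycle_at G w c" "\<And>d. cycle_at G w d \<Longrightarrow> d = c"
    let ?s = "\<Sum>j=1..M. lpa_scale (\<kappa> j) (L.sp (concat (replicate j c)) {w}) :: ('v, 'e, 'k) lpa_prod"
    assume in_I: "embed G (pf {w}) + ?s \<in> preimage_ideal G I"
    \<comment> \<open>The powers \<open>j = 1..M\<close> are renumbered as \<open>i = j + 1\<close>,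
      since the sum in the theorem starts at 2.\<close>
    let ?f = "\<Sum>i=2..Suc M. scale (\<kappa> (i - 1)) (sf_path c ^ (i - 1)) :: ('v, 'e, 'k) free_alg"
    let ?z = "(pf {w} + ?f) * pf {w}"
    have gv: "{w} \<in> gen_verts G" using w by (rule gen_verts.vertex)
    have w_rng: "w \<in> path_rng G c" and edges: "set (concat (replicate j c)) \<subseteq> edges G" for j
      using c(1) closed_path_edges[of G w c] by (auto simp: cycle_at_def closed_path_at_def)
    have "?f = (\<Sum>j=1..M. scale (\<kappa> j) (sf_path (concat (replicate j c))))"
      by (rule sum.reindex_bij_witness[of _ Suc "\<lambda>i. i - 1"]) (auto simp: sf_path_power)
    then have z: "?z = pf {w} * pf {w} +
        (\<Sum>j=1..M. scale (\<kappa> j) (sf_path (concat (replicate j c)) * pf {w}))"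
      by (simp add: distrib_right sum_distrib_right scale_mult_left)
    have terms: "embed G (scale (\<kappa> j) (sf_path (concat (replicate j c)) * pf {w})) =
        lpa_scale (\<kappa> j) (L.sp (concat (replicate j c)) {w})"
      "scale (\<kappa> j) (sf_path (concat (replicate j c)) * pf {w}) \<in> free_carrier G" for j
      using embed_path[OF edges gv] by (simp_all add: embed_hom free_carrier_scale)
    have z_carrier: "?z \<in> free_carrier G"
      unfolding z using terms gv
      by (intro free_carrier_add free_carrier_sum free_carrier_mult free_carrier_gens)
    have embed_z: "embed G ?z = embed G (pf {w}) + ?s"
      unfolding z using terms gv
      by (simp add: embed_hom embed_sum free_carrier_sum free_carrier_mult free_carrier_gens L.rel)
    \<comment> \<open>The exponent at index 1 must be positive as well, although the sum starts at
      2; \<open>i - 1\<close> would be 0 there.\<close>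
    let ?r = "\<lambda>i::nat. if i = 1 then 1 else i - 1"
    have "?f = (\<Sum>i=2..Suc M. scale (\<kappa> (i - 1)) (sf_path c ^ ?r i))"
      by (intro sum.cong) auto
    then have "special_generator G (lpa_class G ?z)"
    proof (intro special_generatorI)
      show "{w} \<in> gen_verts G" by fact
      show "(\<exists>i\<in>{2..Suc M}. \<kappa> (i - 1) \<noteq> 0) \<longrightarrow> cycle_at G w c \<and> {w} \<subseteq> path_rng G c \<and>
          (\<forall>d. cycle_at G w d \<and> {w} \<subseteq> path_rng G d \<longrightarrow> d = c)"
        using c(1) w_rng by (simp add: c(2))
      show "\<forall>i\<in>{1..Suc M}. 0 < ?r i" by auto
      show "finite {}" "{} \<subseteq> edges G" "\<forall>e\<in>{}. src G e = w" "w \<in> {w}" by simp_all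
    qed simp
    then show "embed G (pf {w}) + ?s \<in> preimage_ideal G J"
      using transfer_gen[of ?z ?z, OF _ refl z_carrier z_carrier] in_I unfolding embed_z by blast
  qed
  show ?thesis
  proof
    fix X assume "X \<in> I"
    moreover from this obtain x where x: "x \<in> free_carrier G" "X = lpa_class G x"
      using assms(1) by (auto simp: two_sided_ideal_def LPA_def)
    ultimately have "embed G x \<in> preimage_ideal G I"
      by (simp add: embed_in_preimage_ideal)
    then have "embed G x \<in> preimage_ideal G J"
      using embed_in_ghost_part[OF x(1)] in_J by blast
    then show "X \<in> J"
      using x by (simp add: embed_in_preimage_ideal)
  qed
qed

theorem theorem2p4:
  fixes G :: "('v, 'e) ultragraph"
    and I :: "('v, 'e, 'k::field) free_alg set set"
  assumes "is_ultragraph G"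
    and "two_sided_ideal (LPA G) I"
  shows "\<exists>X. X \<subseteq> I \<and> ideal_generated_by (LPA G) X = I \<and>
    (\<forall>x\<in>X. \<exists>A v S c (m::nat) (k::nat \<Rightarrow> 'k) (r::nat \<Rightarrow> nat).
       A \<in> gen_verts G \<and> v \<in> A \<and>
       finite S \<and> S \<subseteq> edges G \<and> (\<forall>e\<in>S. src G e = v) \<and>
       (\<forall>i\<in>{1..m}. 0 < r i) \<and>
       ((\<exists>i\<in>{2..m}. k i \<noteq> 0) \<longrightarrow>
          cycle_at G v c \<and> A \<subseteq> path_rng G c \<and>
          (\<forall>d. cycle_at G v d \<and> A \<subseteq> path_rng G d \<longrightarrow> d = c)) \<and>
       x = lpa_class G
             ((pf A + (\<Sum>i=2..m. scale (k i) (sf_path c ^ r i))) *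
              (pf A - (\<Sum>e\<in>S. sf e * sf' e))))"
proof -
  interpret lpa_embedding G "TYPE('k)"
    using assms(1) by unfold_locales
  \<comment> \<open>The largest possible choice: an ideal contains \<open>X\<close> exactly when it
    contains every special element of \<open>I\<close>.\<close>
  define X where "X = {x \<in> I. special_generator G x}"
  have "ideal_generated_by (LPA G) X = I"
  proof
    show "ideal_generated_by (LPA G) X \<subseteq> I"
      using assms(2) by (auto simp: ideal_generated_by_def X_def)
    show "I \<subseteq> ideal_generated_by (LPA G) X"
      unfolding ideal_generated_by_def
    proof (rule Inter_greatest)
      fix J assume "J \<in> {J. two_sided_ideal (LPA G) J \<and> X \<subseteq> J}"
      then show "I \<subseteq> J"
        using assms(2) by (intro ideal_subset) (auto simp: X_def)
    qed
  qed
  moreover have "\<forall>x\<in>X. special_generator G x" "X \<subseteq> I"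
    by (auto simp: X_def)
  ultimately show ?thesis
    unfolding special_generator_def by blast
qed

end
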